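(* Let $a>1$ and $f=f_a$. Then $\mathbf{R}^2\setminus(\mathcal{B}^+\cup\mathcal{B}^-)=K$. Moreover, the set $K$ is compact in $\mathbf{R}^2$ and is contained in the square $[-a,1]\times[-1,a]$.
   Context: For $a>1$, $f=f_a$ is the plane birational map $f_a(x,y)=\left(y\,\frac{x+a}{x-1},\,x+a-1\right)$, with inverse $f^{-1}(x,y)=\left(y+1-a,\ \frac{x(y-a)}{1+y}\right)$. Let $\overline{\mathbf{R}^2}=(\mathbf{R}\cup\{\infty\})\times(\mathbf{R}\cup\{\infty\})\cong S^1\times S^1$. The map $f$ extends continuously to $\overline{\mathbf{R}^2}\setminus I(f)$ with values in $\overline{\mathbf{R}^2}$, where $I(f)=\{(-a,\infty),(1,0)\}$, and $f^{-1}$ extends continuously to $\overline{\mathbf{R}^2}\setminus I(f^{-1})$, where $I(f^{-1})=\{(0,-1),(\infty,a)\}$. Forward and backward orbits are taken with respect to these extensions; the point $(\infty,\infty)$ is fixed. $\mathcal{B}^+\subset\mathbf{R}^2$ (respectively $\mathcal{B}^-\subset\mathbf{R}^2$) is the set of points whose orbits diverge locally uniformly to infinity in forward (respectively backward) time: $p\in\mathcal{B}^{+}$ iff $p$ has a neighborhood $U$ such that $f^n|_U$ is well-defined for all $n\in\mathbf{N}$ and converges uniformly on $U$ to $(\infty,\infty)$; $\mathcal{B}^-$ is defined in the same way with $f^{-1}$ in place of $f$. $K\subset\mathbf{R}^2$ is the set of points $p$ whose full orbit $(f^n(p))_{n\in\mathbf{Z}}$ is (well-defined and) bounded in $\mathbf{R}^2$.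 *)

theory Defs
  imports "HOL-Analysis.Analysis"
begin

section \<open>The compactified plane\<close>

text \<open>\<open>None\<close> is the point at infinity of the one-point compactification of the real line.\<close>

definition rline :: "real option topology" where
  "rline = Alexandroff_compactification euclideanreal"

definition torus :: "(real option \<times> real option) topology" where
  "torus = prod_topology rline rline"

definition emb :: "real \<times> real \<Rightarrow> real option \<times> real option" where
  "emb p = (Some (fst p), Some (snd p))"

text \<open>The continuous extension to \<open>S\<close> of a map given by \<open>h\<close> on \<open>D \<subseteq> \<real>\<^sup>2\<close>; extensionality only
  fixes the irrelevant values outside \<open>S\<close>.\<close>

definition is_cont_ext ::
  "(real option \<times> real option) set \<Rightarrow> (real \<times> real) set \<Rightarrow> (real \<times> real \<Rightarrow> real \<times> real)
    \<Rightarrow> (real option \<times> real option \<Rightarrow> real option \<times> real option) \<Rightarrow> bool" where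
  "is_cont_ext S D h g \<longleftrightarrow>
     g \<in> extensional S \<and> continuous_map (subtopology torus S) torus g \<and>
     (\<forall>p\<in>D. g (emb p) = emb (h p))"

definition cont_ext ::
  "(real option \<times> real option) set \<Rightarrow> (real \<times> real) set \<Rightarrow> (real \<times> real \<Rightarrow> real \<times> real)
    \<Rightarrow> (real option \<times> real option \<Rightarrow> real option \<times> real option)" where
  "cont_ext S D h = (THE g. is_cont_ext S D h g)"

section \<open>The birational map and its inverse\<close>

text \<open>These formulas are meaningful only off \<open>x = 1\<close>, respectively off \<open>y = -1\<close>.\<close>

definition fmap :: "real \<Rightarrow> real \<times> real \<Rightarrow> real \<times> real" where
  "fmap a = (\<lambda>(x, y). (y * ((x + a) / (x - 1)), x + a - 1))"

definition finv :: "real \<Rightarrow> real \<times> real \<Rightarrow> real \<times> real" where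
  "finv a = (\<lambda>(x, y). (y + 1 - a, x * (y - a) / (1 + y)))"

definition indet_f :: "real \<Rightarrow> (real option \<times> real option) set" where
  "indet_f a = {(Some (- a), None), (Some 1, Some 0)}"

definition indet_finv :: "real \<Rightarrow> (real option \<times> real option) set" where
  "indet_finv a = {(Some 0, Some (- 1)), (None, Some a)}"

definition f_ext :: "real \<Rightarrow> real option \<times> real option \<Rightarrow> real option \<times> real option" where
  "f_ext a = cont_ext (- indet_f a) {(x, y). x \<noteq> 1} (fmap a)"

definition finv_ext :: "real \<Rightarrow> real option \<times> real option \<Rightarrow> real option \<times> real option" where
  "finv_ext a = cont_ext (- indet_finv a) {(x, y). y \<noteq> - 1} (finv a)"

section \<open>Basins of infinity and the set of bounded orbits\<close>

text \<open>\<open>g\<^sup>n\<close> is defined at \<open>p\<close>, where \<open>g\<close> is only meaningful off \<open>I\<close>.\<close>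

definition iter_defined ::
  "(real option \<times> real option) set \<Rightarrow> (real option \<times> real option \<Rightarrow> real option \<times> real option)
    \<Rightarrow> nat \<Rightarrow> real option \<times> real option \<Rightarrow> bool" where
  "iter_defined I g n p \<longleftrightarrow> (\<forall>k<n. (g ^^ k) p \<notin> I)"

text \<open>Since the torus is compact Hausdorff, it has a unique compatible uniformity, and uniform
  convergence on \<open>U\<close> to a constant means that every neighbourhood of the constant eventually
  contains the whole image of \<open>U\<close>.\<close>

definition basin ::
  "(real option \<times> real option) set \<Rightarrow> (real option \<times> real option \<Rightarrow> real option \<times> real option)
    \<Rightarrow> (real \<times> real) set" where
  "basin I g = {p. \<exists>U. open U \<and> p \<in> U \<and>
     (\<forall>n. \<forall>q\<in>U. iter_defined I g n (emb q)) \<and>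
     (\<forall>V. openin torus V \<and> (None, None) \<in> V \<longrightarrow>
        (\<forall>\<^sub>F n in sequentially. \<forall>q\<in>U. (g ^^ n) (emb q) \<in> V))}"

definition Bplus :: "real \<Rightarrow> (real \<times> real) set" where
  "Bplus a = basin (indet_f a) (f_ext a)"

definition Bminus :: "real \<Rightarrow> (real \<times> real) set" where
  "Bminus a = basin (indet_finv a) (finv_ext a)"

definition full_orbit :: "real \<Rightarrow> real \<times> real \<Rightarrow> int \<Rightarrow> real option \<times> real option" where
  "full_orbit a p n =
     (if n \<ge> 0 then (f_ext a ^^ nat n) (emb p) else (finv_ext a ^^ nat (- n)) (emb p))"

definition K_set :: "real \<Rightarrow> (real \<times> real) set" where
  "K_set a = {p.
     (\<forall>n. iter_defined (indet_f a) (f_ext a) n (emb p)) \<and>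
     (\<forall>n. iter_defined (indet_finv a) (finv_ext a) n (emb p)) \<and>
     (\<exists>B. bounded B \<and> range (full_orbit a p) \<subseteq> emb ` B)}"

section \<open>Existence and uniqueness of the extensions\<close>

text \<open>Explicit formulas in homogeneous coordinates: \<open>pr p q\<close> is the point \<open>[p : q]\<close> for \<open>(p, q) \<noteq> (0, 0)\<close>.\<close>

definition pr :: "real \<Rightarrow> real \<Rightarrow> real option" where
  "pr p q = (if q = 0 then None else Some (p / q))"

definition hcoord :: "real option \<Rightarrow> real \<times> real" where
  "hcoord z = (case z of None \<Rightarrow> (1, 0) | Some x \<Rightarrow> (x, 1))"

lemma pr_scale: "t \<noteq> 0 \<Longrightarrow> pr (t * p) (t * q) = pr p q"
  by (simp add: pr_def)

lemma topspace_rline [simp]: "topspace rline = UNIV"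
  by (simp add: rline_def UNIV_option_conv)

lemma topspace_torus [simp]: "topspace torus = UNIV"
  by (simp add: torus_def)

lemma Hausdorff_rline: "Hausdorff_space rline"
  by (simp add: rline_def Hausdorff_space_Alexandroff_compactification
      locally_compact_space_euclidean Hausdorff_space_euclidean)

lemma Hausdorff_torus: "Hausdorff_space torus"
  by (simp add: torus_def Hausdorff_space_prod_topology Hausdorff_rline)

lemma openin_rline:
  "openin rline V \<longleftrightarrow> open (Some -` V) \<and> (None \<in> V \<longrightarrow> bounded (- (Some -` V)))"
proof -
  have *: "V = insert None (Some ` (UNIV - C)) \<longleftrightarrow> None \<in> V \<and> C = - (Some -` V)" for C
    by (auto simp: set_eq_iff image_iff split_option_all)
  have **: "V = Some ` U \<longleftrightarrow> None \<notin> V \<and> U = Some -` V" for U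
    by (auto simp: set_eq_iff image_iff split_option_all)
  show ?thesis
    unfolding rline_def openin_Alexandroff_compactification
    by (auto simp: * ** compact_eq_bounded_closed open_closed)
qed

lemma cont_Some: "continuous_map euclidean rline Some"
  using continuous_map_Some[of euclideanreal] by (simp add: rline_def)

lemma open_inverse_image:
  fixes W :: "real set"
  assumes "open W"
  shows "open {u. u \<noteq> 0 \<and> inverse u \<in> W}"
proof -
  have "continuous_on (- {0::real}) inverse"
    by (intro continuous_intros) auto
  then have "open (inverse -` W \<inter> - {0})"
    using assms by (metis continuous_on_open_vimage open_delete open_UNIV Compl_eq_Diff_UNIV)
  moreover have "inverse -` W \<inter> - {0} = {u. u \<noteq> 0 \<and> inverse u \<in> W}" by auto
  ultimately show ?thesis by simp
qed

lemma cont_pr1: "continuous_map euclidean rline (pr 1)"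
proof -
  have "open {x. pr 1 x \<in> V}" if V: "openin rline V" for V
  proof -
    define W where "W = {u. u \<noteq> 0 \<and> inverse u \<in> Some -` V}"
    have W: "open W"
      using V open_inverse_image unfolding W_def openin_rline by blast
    show ?thesis
    proof (cases "None \<in> V")
      case False
      then have "{x. pr 1 x \<in> V} = W" by (auto simp: pr_def W_def inverse_eq_divide)
      then show ?thesis using W by simp
    next
      case True
      then obtain B where B: "B > 0" "\<And>x. Some x \<notin> V \<Longrightarrow> \<bar>x\<bar> \<le> B"
        using V unfolding openin_rline bounded_pos by (auto simp: real_norm_def)
      have "{x. pr 1 x \<in> V} = W \<union> ball 0 (1 / B)"
      proof (intro set_eqI iffI)
        fix x assume "x \<in> W \<union> ball 0 (1 / B)"
        then show "x \<in> {x. pr 1 x \<in> V}"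
        proof
          assume "x \<in> ball 0 (1 / B)"
          then have x: "\<bar>x\<bar> < 1 / B" by simp
          show ?thesis
          proof (cases "x = 0")
            case False
            then have "\<bar>1 / x\<bar> > B" using x B(1) by (simp add: field_simps)
            then have "Some (1 / x) \<in> V" using B(2) by (meson not_less)
            then show ?thesis using False by (simp add: pr_def)
          qed (use True in \<open>simp add: pr_def\<close>)
        qed (auto simp: pr_def W_def inverse_eq_divide)
      next
        fix x assume "x \<in> {x. pr 1 x \<in> V}"
        then show "x \<in> W \<union> ball 0 (1 / B)"
          using B(1) by (cases "x = 0") (auto simp: pr_def W_def inverse_eq_divide)
      qed
      then show ?thesis using W by auto
    qed
  qed
  then show ?thesis by (simp add: continuous_map)
qed

lemma open_map_pr1: 
  assumes "open U" shows "openin rline (pr 1 ` U)"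
proof -
  have "Some -` (pr 1 ` U) = {u. u \<noteq> 0 \<and> inverse u \<in> U}"
  proof (intro set_eqI iffI)
    fix x assume "x \<in> {u. u \<noteq> 0 \<and> inverse u \<in> U}"
    then have "inverse x \<in> U" "Some x = pr 1 (inverse x)"
      by (simp_all add: pr_def inverse_eq_divide)
    then show "x \<in> Some -` (pr 1 ` U)" by blast
  qed (auto simp: pr_def inverse_eq_divide split: if_splits)
  moreover have "bounded (- (Some -` (pr 1 ` U)))" if "None \<in> pr 1 ` U"
  proof -
    have "0 \<in> U" using that by (auto simp: pr_def split: if_splits)
    then obtain e where e: "e > 0" "ball 0 e \<subseteq> U" using assms openE by blast
    have "\<bar>x\<bar> \<le> 1 / e" if "Some x \<notin> pr 1 ` U" for x
    proof (rule ccontr)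
      assume x: "\<not> \<bar>x\<bar> \<le> 1 / e"
      have "x \<noteq> 0" using x e(1) by auto
      moreover have "\<bar>1 / x\<bar> < e" using x e(1) calculation by (simp add: field_simps)
      ultimately have "1 / x \<in> U" "pr 1 (1 / x) = Some x" using e(2) by (auto simp: pr_def)
      then show False using that by (metis imageI)
    qed
    then show ?thesis unfolding bounded_iff by (intro exI[of _ "1 / e"]) auto
  qed
  ultimately show ?thesis
    using open_inverse_image[OF assms] by (auto simp: openin_rline)
qed

lemma cont_pr: "continuous_map (top_of_set (- {(0, 0)})) rline (\<lambda>(p, q). pr p q)"
proof -
  let ?A = "{z :: real \<times> real. snd z \<noteq> 0}" and ?B = "{z :: real \<times> real. fst z \<noteq> 0}"
  have A: "continuous_map (top_of_set ?A) rline (\<lambda>(p, q). pr p q)"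
  proof (rule continuous_map_eq[where f = "Some \<circ> (\<lambda>z. fst z / snd z)"])
    show "continuous_map (top_of_set ?A) rline (Some \<circ> (\<lambda>z. fst z / snd z))"
      by (rule continuous_map_compose[OF _ cont_Some])
         (auto intro!: continuous_intros)
  qed (auto simp: pr_def)
  have B: "continuous_map (top_of_set ?B) rline (\<lambda>(p, q). pr p q)"
  proof (rule continuous_map_eq[where f = "pr 1 \<circ> (\<lambda>z. snd z / fst z)"])
    show "continuous_map (top_of_set ?B) rline (pr 1 \<circ> (\<lambda>z. snd z / fst z))"
      by (rule continuous_map_compose[OF _ cont_pr1])
         (auto intro!: continuous_intros)
  qed (auto simp: pr_def)
  have oA: "open ?A" and oB: "open ?B"
    by (auto intro!: open_Collect_neq continuous_intros)
  have op: "openin euclidean {z \<in> X. (case z of (p, q) \<Rightarrow> pr p q) \<in> V}"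
    if "open X" "continuous_map (top_of_set X) rline (\<lambda>(p, q). pr p q)" "openin rline V" for X V
    using openin_continuous_map_preimage[OF that(2,3)] that(1)
    by (simp add: openin_open_eq)
  have "openin (top_of_set (- {(0, 0)})) {z \<in> - {(0, 0)}. (case z of (p, q) \<Rightarrow> pr p q) \<in> V}"
    if V: "openin rline V" for V
  proof -
    have "open ({z \<in> ?A. (case z of (p, q) \<Rightarrow> pr p q) \<in> V} \<union> {z \<in> ?B. (case z of (p, q) \<Rightarrow> pr p q) \<in> V})"
      using op[OF oA A V] op[OF oB B V] by (intro open_Un) (simp_all)
    moreover have "{z \<in> ?A. (case z of (p, q) \<Rightarrow> pr p q) \<in> V} \<union> {z \<in> ?B. (case z of (p, q) \<Rightarrow> pr p q) \<in> V}
       = {z \<in> - {(0, 0)}. (case z of (p, q) \<Rightarrow> pr p q) \<in> V}" by auto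
    ultimately show ?thesis
      by (simp add: openin_open_eq open_Compl)
  qed
  then show ?thesis by (simp add: continuous_map)
qed

text \<open>Affine charts at zero and at infinity, with their homogeneous coordinates.\<close>

definition hv :: "bool \<Rightarrow> real \<Rightarrow> real \<times> real" where
  "hv i u = (if i then (1, u) else (u, 1))"

definition chart :: "bool \<Rightarrow> real \<Rightarrow> real option" where
  "chart i = (if i then pr 1 else Some)"

lemma cont_chart: "continuous_map euclidean rline (chart i)"
  by (simp add: chart_def cont_Some cont_pr1)

lemma open_map_chart: "open U \<Longrightarrow> openin rline (chart i ` U)"
  using open_map_Some[of euclideanreal]
  using open_map_pr1 by (cases i) (auto simp: chart_def rline_def open_map_def)

lemma chart_surj: "\<exists>i u. z = chart i u"
proof (cases z)
  case None
  then have "z = chart True 0" by (simp add: chart_def pr_def)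
  then show ?thesis by blast
next
  case (Some x)
  then have "z = chart False x" by (simp add: chart_def)
  then show ?thesis by blast
qed

lemma hcoord_chart: "\<exists>t. t \<noteq> 0 \<and> hcoord (chart i u) = (t * fst (hv i u), t * snd (hv i u))"
proof (cases "i \<and> u \<noteq> 0")
  case True
  then show ?thesis by (intro exI[of _ "1 / u"]) (auto simp: hcoord_def chart_def pr_def hv_def)
next
  case False
  then show ?thesis by (intro exI[of _ 1]) (auto simp: hcoord_def chart_def pr_def hv_def)
qed

definition chart2 :: "bool \<Rightarrow> bool \<Rightarrow> real \<times> real \<Rightarrow> real option \<times> real option" where
  "chart2 i j z = (chart i (fst z), chart j (snd z))"

lemma cont_chart2: "continuous_map euclidean torus (chart2 i j)"
proof -
  have "continuous_map euclidean rline (chart i \<circ> fst)" "continuous_map euclidean rline (chart j \<circ> snd)"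
    by (rule continuous_map_compose[OF _ cont_chart], simp add: continuous_on_fst continuous_on_snd continuous_on_id)+
  then show ?thesis
    unfolding torus_def chart2_def by (simp add: continuous_map_pairwise o_def)
qed

lemma open_map_chart2:
  assumes "open U" shows "openin torus (chart2 i j ` U)"
  unfolding torus_def openin_prod_topology_alt
proof (intro allI impI)
  fix x y assume "(x, y) \<in> chart2 i j ` U"
  then obtain u v where uv: "(u, v) \<in> U" "x = chart i u" "y = chart j v"
    by (auto simp: chart2_def)
  then obtain A B where AB: "open A" "open B" "u \<in> A" "v \<in> B" "A \<times> B \<subseteq> U"
    proof -
    obtain A B where AB: "open A" "open B" "(u, v) \<in> A \<times> B" "A \<times> B \<subseteq> U"
      by (rule open_prod_elim[OF assms uv(1)])
    then show ?thesis using that by simp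
  qed
  have "chart i ` A \<times> chart j ` B \<subseteq> chart2 i j ` U"
    using AB(5) by (force simp: chart2_def)
  then show "\<exists>U' V. openin rline U' \<and> openin rline V \<and> x \<in> U' \<and> y \<in> V \<and> U' \<times> V \<subseteq> chart2 i j ` U"
    using AB(3,4) uv open_map_chart[OF AB(1), of i] open_map_chart[OF AB(2), of j]
    by (intro exI[of _ "chart i ` A"] exI[of _ "chart j ` B"]) auto
qed

lemma continuous_map_via_charts:
  assumes S: "openin torus S"
    and P: "continuous_on UNIV P" and Q: "continuous_on UNIV Q"
    and g: "\<And>i j u v. chart2 i j (u, v) \<in> S \<Longrightarrow>
        g (chart2 i j (u, v)) = pr (P (hv i u, hv j v)) (Q (hv i u, hv j v))"
    and nz: "\<And>i j u v. chart2 i j (u, v) \<in> S \<Longrightarrow>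
        P (hv i u, hv j v) \<noteq> 0 \<or> Q (hv i u, hv j v) \<noteq> 0"
  shows "continuous_map (subtopology torus S) rline g"
proof -
  have chart_cont: "open {z. chart2 i j z \<in> S \<and> g (chart2 i j z) \<in> V}" if V: "openin rline V" for i j V
  proof -
    define D where "D = {z. chart2 i j z \<in> S}"
    define H where "H = (\<lambda>z. (P (hv i (fst z), hv j (snd z)), Q (hv i (fst z), hv j (snd z))))"
    have D: "open D"
      using openin_continuous_map_preimage[OF cont_chart2 S] by (simp add: D_def)
    have hv: "continuous_on UNIV (\<lambda>z. (hv i (fst z), hv j (snd z)))"
      by (cases i; cases j) (simp_all add: hv_def continuous_on_Pair continuous_on_fst continuous_on_snd continuous_on_const continuous_on_id)
    have H: "continuous_on D H"
      unfolding H_def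
      by (rule continuous_on_Pair; rule continuous_on_subset[OF _ subset_UNIV])
         (rule continuous_on_compose2[OF P hv subset_UNIV] continuous_on_compose2[OF Q hv subset_UNIV])+
    have "continuous_map (top_of_set D) (top_of_set (- {(0, 0)})) H"
      using H nz by (auto simp: continuous_map_in_subtopology H_def D_def chart2_def)
    then have "continuous_map (top_of_set D) rline ((\<lambda>(p, q). pr p q) \<circ> H)"
      by (rule continuous_map_compose[OF _ cont_pr])
    from openin_continuous_map_preimage[OF this V] D
    have "open {z \<in> D. ((\<lambda>(p, q). pr p q) \<circ> H) z \<in> V}"
      by (simp add: openin_open_eq)
    moreover have "{z \<in> D. ((\<lambda>(p, q). pr p q) \<circ> H) z \<in> V} = {z. chart2 i j z \<in> S \<and> g (chart2 i j z) \<in> V}"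
      using g by (auto simp: D_def H_def)
    ultimately show ?thesis by simp
  qed
  have "openin (subtopology torus S) {p \<in> S. g p \<in> V}" if V: "openin rline V" for V
  proof -
    have "{p \<in> S. g p \<in> V} = (\<Union>i. \<Union>j. chart2 i j ` {z. chart2 i j z \<in> S \<and> g (chart2 i j z) \<in> V})"
    proof (intro set_eqI iffI)
      fix p assume p: "p \<in> {p \<in> S. g p \<in> V}"
      obtain i u j v where "fst p = chart i u" "snd p = chart j v"
        using chart_surj by metis
      then have "p = chart2 i j (u, v)" by (simp add: chart2_def prod_eq_iff)
      with p show "p \<in> (\<Union>i. \<Union>j. chart2 i j ` {z. chart2 i j z \<in> S \<and> g (chart2 i j z) \<in> V})"
        by blast
    qed auto
    moreover have "openin torus (\<Union>i. \<Union>j. chart2 i j ` {z. chart2 i j z \<in> S \<and> g (chart2 i j z) \<in> V})"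
    proof (rule openin_Union; clarsimp)
      fix i
      show "openin torus (\<Union>j. chart2 i j ` {z. chart2 i j z \<in> S \<and> g (chart2 i j z) \<in> V})"
        by (rule openin_Union) (use open_map_chart2 chart_cont[OF V] in blast)
    qed
    ultimately have "openin torus {p \<in> S. g p \<in> V}" by simp
    then show ?thesis
      by (simp add: openin_open_subtopology[OF S] subset_eq)
  qed
  then show ?thesis by (simp add: continuous_map)
qed

definition Fx :: "real \<Rightarrow> real option \<times> real option \<Rightarrow> real option \<times> real option" where
  "Fx a = (\<lambda>(x, y). let (x0, x1) = hcoord x; (y0, y1) = hcoord y in
     (pr (y0 * (x0 + a * x1)) (y1 * (x0 - x1)), pr (x0 + (a - 1) * x1) x1))"

definition Finvx :: "real \<Rightarrow> real option \<times> real option \<Rightarrow> real option \<times> real option" where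
  "Finvx a = (\<lambda>(x, y). let (x0, x1) = hcoord x; (y0, y1) = hcoord y in
     (pr (y0 + (1 - a) * y1) y1, pr (x0 * (y0 - a * y1)) (x1 * (y1 + y0))))"

lemma pr_scale': "t \<noteq> 0 \<Longrightarrow> p' = t * p \<Longrightarrow> q' = t * q \<Longrightarrow> pr p' q' = pr p q"
  by (simp add: pr_scale)

lemma Fx_chart:
  assumes "hv i u = (x0, x1)" "hv j v = (y0, y1)"
  shows "Fx a (chart2 i j (u, v)) = (pr (y0 * (x0 + a * x1)) (y1 * (x0 - x1)), pr (x0 + (a - 1) * x1) x1)"
proof -
  obtain s where s: "s \<noteq> 0" "hcoord (chart i u) = (s * x0, s * x1)"
    using hcoord_chart[of i u] assms by auto
  obtain t where t: "t \<noteq> 0" "hcoord (chart j v) = (t * y0, t * y1)"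
    using hcoord_chart[of j v] assms by auto
  have "pr (t * y0 * (s * x0 + a * (s * x1))) (t * y1 * (s * x0 - s * x1)) = pr (y0 * (x0 + a * x1)) (y1 * (x0 - x1))"
    by (rule pr_scale'[of "s * t"]) (use s t in \<open>auto simp: algebra_simps\<close>)
  moreover have "pr (s * x0 + (a - 1) * (s * x1)) (s * x1) = pr (x0 + (a - 1) * x1) x1"
    by (rule pr_scale'[of s]) (use s in \<open>auto simp: algebra_simps\<close>)
  ultimately show ?thesis by (simp add: Fx_def chart2_def s t)
qed

lemma Finvx_chart:
  assumes "hv i u = (x0, x1)" "hv j v = (y0, y1)"
  shows "Finvx a (chart2 i j (u, v)) = (pr (y0 + (1 - a) * y1) y1, pr (x0 * (y0 - a * y1)) (x1 * (y1 + y0)))"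
proof -
  obtain s where s: "s \<noteq> 0" "hcoord (chart i u) = (s * x0, s * x1)"
    using hcoord_chart[of i u] assms by auto
  obtain t where t: "t \<noteq> 0" "hcoord (chart j v) = (t * y0, t * y1)"
    using hcoord_chart[of j v] assms by auto
  have "pr (s * x0 * (t * y0 - a * (t * y1))) (s * x1 * (t * y1 + t * y0)) = pr (x0 * (y0 - a * y1)) (x1 * (y1 + y0))"
    by (rule pr_scale'[of "s * t"]) (use s t in \<open>auto simp: algebra_simps\<close>)
  moreover have "pr (t * y0 + (1 - a) * (t * y1)) (t * y1) = pr (y0 + (1 - a) * y1) y1"
    by (rule pr_scale'[of t]) (use t in \<open>auto simp: algebra_simps\<close>)
  ultimately show ?thesis by (simp add: Finvx_def chart2_def s t)
qed

lemma openin_Compl_finite: "finite A \<Longrightarrow> openin torus (- A)"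
  using closedin_Hausdorff_finite[OF Hausdorff_torus, of A]
  by (simp add: closedin_def Compl_eq_Diff_UNIV)

lemma chart_eq_pr: "chart i u = pr (fst (hv i u)) (snd (hv i u))"
  by (simp add: chart_def pr_def hv_def)

lemma hv_nonzero: "fst (hv i u) \<noteq> 0 \<or> snd (hv i u) \<noteq> 0"
  by (simp add: hv_def)

lemma Fx_continuous:
  assumes "a > 1"
  shows "continuous_map (subtopology torus (- indet_f a)) torus (Fx a)"
proof -
  have S: "openin torus (- indet_f a)" by (rule openin_Compl_finite) (simp add: indet_f_def)
  have "continuous_map (subtopology torus (- indet_f a)) rline (fst \<circ> Fx a)"
  proof (rule continuous_map_via_charts[OF S,
        where P = "\<lambda>(x, y). fst y * (fst x + a * snd x)" and Q = "\<lambda>(x, y). snd y * (fst x - snd x)"])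
    fix i j u v assume S: "chart2 i j (u, v) \<in> - indet_f a"
    show "(fst \<circ> Fx a) (chart2 i j (u, v)) = pr (case (hv i u, hv j v) of (x, y) \<Rightarrow> fst y * (fst x + a * snd x))
       (case (hv i u, hv j v) of (x, y) \<Rightarrow> snd y * (fst x - snd x))"
      by (simp add: Fx_chart[of i u "fst (hv i u)" "snd (hv i u)" j v "fst (hv j v)" "snd (hv j v)"])
    show "(case (hv i u, hv j v) of (x, y) \<Rightarrow> fst y * (fst x + a * snd x)) \<noteq> 0 \<or>
       (case (hv i u, hv j v) of (x, y) \<Rightarrow> snd y * (fst x - snd x)) \<noteq> 0"
    proof (rule ccontr)
      obtain x0 x1 y0 y1 where h: "hv i u = (x0, x1)" "hv j v = (y0, y1)" by fastforce
      have x: "x0 \<noteq> 0 \<or> x1 \<noteq> 0" and y: "y0 \<noteq> 0 \<or> y1 \<noteq> 0"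
        using hv_nonzero[of i u] hv_nonzero[of j v] h by auto
      have c: "chart2 i j (u, v) = (pr x0 x1, pr y0 y1)"
        by (simp add: chart2_def chart_eq_pr h)
      assume "\<not> ?thesis"
      then have z: "y0 * (x0 + a * x1) = 0" "y1 * (x0 - x1) = 0" by (auto simp: h)
      show False
      proof (cases "x0 = x1")
        case True
        then have "x1 \<noteq> 0" using x by simp
        moreover have "x0 + a * x1 = (1 + a) * x1" using True by (simp add: algebra_simps)
        ultimately have "y0 = 0" using z(1) assms by simp
        then show False using S c True \<open>x1 \<noteq> 0\<close> y by (simp add: pr_def indet_f_def)
      next
        case False
        then have "y1 = 0" using z(2) by simp
        then have "x0 = - a * x1" using y z(1) by simp
        moreover have "x1 \<noteq> 0" using calculation x by auto
        ultimately have "pr x0 x1 = Some (- a)" by (simp add: pr_def)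
        then show False using S c \<open>y1 = 0\<close> by (auto simp: pr_def indet_f_def)
      qed
    qed
  qed (auto simp: case_prod_beta intro!: continuous_intros)
  moreover have "continuous_map (subtopology torus (- indet_f a)) rline (snd \<circ> Fx a)"
  proof (rule continuous_map_via_charts[OF S,
        where P = "\<lambda>(x, y). fst x + (a - 1) * snd x" and Q = "\<lambda>(x, y). snd x"])
    fix i j u v assume S: "chart2 i j (u, v) \<in> - indet_f a"
    show "(snd \<circ> Fx a) (chart2 i j (u, v)) = pr (case (hv i u, hv j v) of (x, y) \<Rightarrow> fst x + (a - 1) * snd x)
       (case (hv i u, hv j v) of (x, y) \<Rightarrow> snd x)"
      by (simp add: Fx_chart[of i u "fst (hv i u)" "snd (hv i u)" j v "fst (hv j v)" "snd (hv j v)"])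
    show "(case (hv i u, hv j v) of (x, y) \<Rightarrow> fst x + (a - 1) * snd x) \<noteq> 0 \<or>
       (case (hv i u, hv j v) of (x, y) \<Rightarrow> snd x) \<noteq> 0"
      by (auto simp: hv_def)
  qed (auto simp: case_prod_beta intro!: continuous_intros)
  ultimately show ?thesis by (simp add: torus_def continuous_map_pairwise)
qed

lemma Finvx_continuous:
  assumes "a > 1"
  shows "continuous_map (subtopology torus (- indet_finv a)) torus (Finvx a)"
proof -
  have S: "openin torus (- indet_finv a)" by (rule openin_Compl_finite) (simp add: indet_finv_def)
  have "continuous_map (subtopology torus (- indet_finv a)) rline (snd \<circ> Finvx a)"
  proof (rule continuous_map_via_charts[OF S,
        where P = "\<lambda>(x, y). fst x * (fst y - a * snd y)" and Q = "\<lambda>(x, y). snd x * (snd y + fst y)"])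
    fix i j u v assume S: "chart2 i j (u, v) \<in> - indet_finv a"
    show "(snd \<circ> Finvx a) (chart2 i j (u, v)) = pr (case (hv i u, hv j v) of (x, y) \<Rightarrow> fst x * (fst y - a * snd y))
       (case (hv i u, hv j v) of (x, y) \<Rightarrow> snd x * (snd y + fst y))"
      by (simp add: Finvx_chart[of i u "fst (hv i u)" "snd (hv i u)" j v "fst (hv j v)" "snd (hv j v)"])
    show "(case (hv i u, hv j v) of (x, y) \<Rightarrow> fst x * (fst y - a * snd y)) \<noteq> 0 \<or>
       (case (hv i u, hv j v) of (x, y) \<Rightarrow> snd x * (snd y + fst y)) \<noteq> 0"
    proof (rule ccontr)
      obtain x0 x1 y0 y1 where h: "hv i u = (x0, x1)" "hv j v = (y0, y1)" by fastforce
      have x: "x0 \<noteq> 0 \<or> x1 \<noteq> 0" and y: "y0 \<noteq> 0 \<or> y1 \<noteq> 0"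
        using hv_nonzero[of i u] hv_nonzero[of j v] h by auto
      have c: "chart2 i j (u, v) = (pr x0 x1, pr y0 y1)"
        by (simp add: chart2_def chart_eq_pr h)
      assume "\<not> ?thesis"
      then have z: "x0 * (y0 - a * y1) = 0" "x1 * (y1 + y0) = 0" by (auto simp: h)
      show False
      proof (cases "y0 = - y1")
        case True
        then have "y1 \<noteq> 0" using y by simp
        moreover have "y0 - a * y1 = - (1 + a) * y1" using True by (simp add: algebra_simps)
        ultimately have "x0 = 0" using z(1) assms by simp
        then show False using S c True \<open>y1 \<noteq> 0\<close> x by (simp add: pr_def indet_finv_def)
      next
        case False
        then have "x1 = 0" using z(2) by simp
        then have "y0 = a * y1" using x z(1) by simp
        moreover have "y1 \<noteq> 0" using calculation y by auto
        ultimately have "pr y0 y1 = Some a" by (simp add: pr_def)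
        then show False using S c \<open>x1 = 0\<close> by (auto simp: pr_def indet_finv_def)
      qed
    qed
  qed (auto simp: case_prod_beta intro!: continuous_intros)
  moreover have "continuous_map (subtopology torus (- indet_finv a)) rline (fst \<circ> Finvx a)"
  proof (rule continuous_map_via_charts[OF S,
        where P = "\<lambda>(x, y). fst y + (1 - a) * snd y" and Q = "\<lambda>(x, y). snd y"])
    fix i j u v assume S: "chart2 i j (u, v) \<in> - indet_finv a"
    show "(fst \<circ> Finvx a) (chart2 i j (u, v)) = pr (case (hv i u, hv j v) of (x, y) \<Rightarrow> fst y + (1 - a) * snd y)
       (case (hv i u, hv j v) of (x, y) \<Rightarrow> snd y)"
      by (simp add: Finvx_chart[of i u "fst (hv i u)" "snd (hv i u)" j v "fst (hv j v)" "snd (hv j v)"])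
    show "(case (hv i u, hv j v) of (x, y) \<Rightarrow> fst y + (1 - a) * snd y) \<noteq> 0 \<or>
       (case (hv i u, hv j v) of (x, y) \<Rightarrow> snd y) \<noteq> 0"
      by (auto simp: hv_def)
  qed (auto simp: case_prod_beta intro!: continuous_intros)
  ultimately show ?thesis by (simp add: torus_def continuous_map_pairwise)
qed

lemma openin_rline_infinite:
  assumes "openin rline V" "V \<noteq> {}"
  shows "infinite (Some -` V)"
proof (cases "None \<in> V")
  case True
  then have "bounded (- (Some -` V))" using assms(1) by (simp add: openin_rline)
  show ?thesis
  proof
    assume "finite (Some -` V)"
    then have "bounded (Some -` V)" by (rule finite_imp_bounded)
    with \<open>bounded (- (Some -` V))\<close> have "bounded (Some -` V \<union> - (Some -` V))"
      unfolding bounded_Un by (rule conjI[rotated])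
    then show False using not_bounded_UNIV[where 'a = real] by (simp only: Compl_partition)
  qed
next
  case False
  obtain z where "z \<in> V" using assms(2) by blast
  with False have "Some -` V \<noteq> {}" by (cases z) auto
  moreover have "open (Some -` V)" using assms(1) by (simp add: openin_rline)
  ultimately show ?thesis using finite_imp_not_open by blast
qed

lemma is_cont_ext_unique:
  assumes S: "openin torus S"
    and D: "emb ` D \<subseteq> S" "{(x, y). x \<noteq> c \<and> y \<noteq> d} \<subseteq> D"
    and g: "is_cont_ext S D h g" and g': "is_cont_ext S D h g'"
  shows "g = g'"
proof (rule extensionalityI[where A = S])
  fix p assume p: "p \<in> S"
  have "p \<in> subtopology torus S closure_of (emb ` D)"
    unfolding in_closure_of
  proof (intro conjI allI impI)
    fix T assume "p \<in> T \<and> openin (subtopology torus S) T"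
    then have T: "(fst p, snd p) \<in> T" "openin torus T"
      by (auto simp: openin_open_subtopology[OF S])
    then obtain A B where AB: "openin rline A" "openin rline B" "fst p \<in> A" "snd p \<in> B" "A \<times> B \<subseteq> T"
      using T(2)[unfolded torus_def openin_prod_topology_alt, rule_format, OF T(1)] by blast
    obtain x where x: "Some x \<in> A" "x \<noteq> c"
    proof -
      have "infinite (Some -` A - {c})" using openin_rline_infinite[OF AB(1)] AB(3) by auto
      then obtain z where "z \<in> Some -` A - {c}" using infinite_imp_nonempty by blast
      then show ?thesis using that[of z] by simp
    qed
    obtain y where y: "Some y \<in> B" "y \<noteq> d"
    proof -
      have "infinite (Some -` B - {d})" using openin_rline_infinite[OF AB(2)] AB(4) by auto
      then obtain z where "z \<in> Some -` B - {d}" using infinite_imp_nonempty by blast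
      then show ?thesis using that[of z] by simp
    qed
    have "(x, y) \<in> D" using x y D(2) by blast
    moreover have "emb (x, y) \<in> T" using x y AB(5) by (auto simp: emb_def)
    ultimately show "\<exists>q. q \<in> emb ` D \<and> q \<in> T" by blast
  qed (use p in simp)
  moreover have "continuous_map (subtopology torus S) torus g"
      "continuous_map (subtopology torus S) torus g'"
    using g g' by (simp_all add: is_cont_ext_def)
  moreover have "g q = g' q" if "q \<in> emb ` D" for q
    using that g g' by (auto simp: is_cont_ext_def)
  ultimately show "g p = g' p"
    using forall_in_closure_of_eq[OF _ Hausdorff_torus, of p "subtopology torus S" "emb ` D" g g']
    by blast
next
  show "g \<in> extensional S" "g' \<in> extensional S"
    using g g' by (simp_all add: is_cont_ext_def)
qed

lemma restrict_continuous_map: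
  "continuous_map (subtopology torus S) torus g \<Longrightarrow> continuous_map (subtopology torus S) torus (restrict g S)"
  by (rule continuous_map_eq) auto

lemma is_cont_ext_Fx:
  assumes "a > 1"
  shows "is_cont_ext (- indet_f a) {(x, y). x \<noteq> 1} (fmap a) (restrict (Fx a) (- indet_f a))"
  unfolding is_cont_ext_def
proof (intro conjI ballI)
  show "continuous_map (subtopology torus (- indet_f a)) torus (restrict (Fx a) (- indet_f a))"
    by (rule restrict_continuous_map[OF Fx_continuous[OF assms]])
  fix p :: "real \<times> real" assume "p \<in> {(x, y). x \<noteq> 1}"
  then show "restrict (Fx a) (- indet_f a) (emb p) = emb (fmap a p)"
    by (cases p) (simp add: emb_def indet_f_def Fx_def fmap_def hcoord_def pr_def add_eq_0_iff)
qed simp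

lemma is_cont_ext_Finvx:
  assumes "a > 1"
  shows "is_cont_ext (- indet_finv a) {(x, y). y \<noteq> - 1} (finv a) (restrict (Finvx a) (- indet_finv a))"
  unfolding is_cont_ext_def
proof (intro conjI ballI)
  show "continuous_map (subtopology torus (- indet_finv a)) torus (restrict (Finvx a) (- indet_finv a))"
    by (rule restrict_continuous_map[OF Finvx_continuous[OF assms]])
  fix p :: "real \<times> real" assume "p \<in> {(x, y). y \<noteq> - 1}"
  then show "restrict (Finvx a) (- indet_finv a) (emb p) = emb (finv a p)"
    by (cases p) (simp add: emb_def indet_finv_def Finvx_def finv_def hcoord_def pr_def add_eq_0_iff)
qed simp

lemma f_ext_eq:
  assumes "a > 1"
  shows "f_ext a = restrict (Fx a) (- indet_f a)"
  unfolding f_ext_def cont_ext_def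
proof (rule the_equality, rule is_cont_ext_Fx[OF assms])
  fix g assume g: "is_cont_ext (- indet_f a) {(x, y). x \<noteq> 1} (fmap a) g"
  show "g = restrict (Fx a) (- indet_f a)"
    by (rule is_cont_ext_unique[OF openin_Compl_finite _ _ g is_cont_ext_Fx[OF assms], of 1 0])
       (auto simp: indet_f_def emb_def)
qed

lemma finv_ext_eq:
  assumes "a > 1"
  shows "finv_ext a = restrict (Finvx a) (- indet_finv a)"
  unfolding finv_ext_def cont_ext_def
proof (rule the_equality, rule is_cont_ext_Finvx[OF assms])
  fix g assume g: "is_cont_ext (- indet_finv a) {(x, y). y \<noteq> - 1} (finv a) g"
  show "g = restrict (Finvx a) (- indet_finv a)"
    by (rule is_cont_ext_unique[OF openin_Compl_finite _ _ g is_cont_ext_Finvx[OF assms], of 0 "- 1"])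
       (auto simp: indet_finv_def emb_def)
qed

end

(* The involution (x, y) |-> (-y, -x) conjugates f to its inverse, so B- is the mirror image of B+.
   Near infinity f exchanges the two coordinates up to slowly varying factors, and there is a region
   (the points with x > 1, y > 0, those with x < -a, 0 < y < 1 - x, and those with x = infinity,
   y > 0) that the second iterate maps to itself; there |x| grows at least linearly in the number
   of steps, which in turn forces y to grow linearly, at rates depending only on a. So the region
   lies in B+. Every point outside the square, or else its mirror image, reaches the region after
   at most one step, and so does every point (1, y) with y nonzero, while the line x = -a is
   contracted to (0, -1), which is mapped into the region, and (1, 0) is the mirror image
   of (0, -1). Hence the complement of the basins avoids the exceptional lines, is invariant under
   f and its inverse, is closed, and lies in the square: it consists of bounded full orbits.
   Conversely a bounded orbit does not converge to infinity. *)

theory Submission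
  imports Defs
begin

section \<open>Boxes around \<open>(None, None)\<close> and general facts about basins\<close>

definition near :: "real \<Rightarrow> (real option \<times> real option) set" where
  "near e = chart2 True True ` (ball 0 e \<times> ball 0 e)"

lemma openin_near: "openin torus (near e)"
  unfolding near_def by (intro open_map_chart2 open_Times open_ball)

lemma infinity_in_near: "e > 0 \<Longrightarrow> (None, None) \<in> near e"
  unfolding near_def by (rule image_eqI[of _ _ "(0, 0)"]) (auto simp: chart2_def chart_def pr_def)

text \<open>In the chart at infinity \<open>(None, None)\<close> is the origin, so the boxes form a
  neighbourhood base and can replace arbitrary open sets in \<open>basin\<close>.\<close>

lemma near_subset_nhd:
  assumes "openin torus V" "(None, None) \<in> V"
  obtains e where "e > 0" "near e \<subseteq> V"
proof -
  have "open {z. chart2 True True z \<in> V}"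
    using openin_continuous_map_preimage[OF cont_chart2[of True True] assms(1)] by simp
  moreover have "(0, 0) \<in> {z. chart2 True True z \<in> V}"
    using assms(2) by (simp add: chart2_def chart_def pr_def)
  ultimately obtain d where d: "d > 0" "\<And>z. dist z (0, 0) < d \<Longrightarrow> chart2 True True z \<in> V"
    unfolding open_dist by (metis mem_Collect_eq)
  have "near (d / 2) \<subseteq> V"
  proof
    fix P assume "P \<in> near (d / 2)"
    then obtain q r where qr: "\<bar>q\<bar> < d / 2" "\<bar>r\<bar> < d / 2" "P = chart2 True True (q, r)"
      by (auto simp: near_def)
    have "dist (q, r) (0, 0) \<le> \<bar>q\<bar> + \<bar>r\<bar>"
      using norm_Pair_le[of q r] by (simp add: dist_norm)
    then show "P \<in> V" using d(2)[of "(q, r)"] qr by simp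
  qed
  then show ?thesis using d(1) that[of "d / 2"] by simp
qed

lemma nearI:
  assumes "\<bar>q\<bar> < e" "\<bar>p\<bar> < e" "P = (pr 1 q, pr 1 p)"
  shows "P \<in> near e"
  unfolding near_def assms(3)
  by (rule image_eqI[of _ _ "(q, p)"]) (use assms in \<open>auto simp: chart2_def chart_def\<close>)

lemma emb_in_near:
  assumes "emb p \<in> near e"
  shows "1 < e * \<bar>fst p\<bar>"
proof -
  obtain q where q: "\<bar>q\<bar> < e" "Some (fst p) = pr 1 q"
    using assms by (auto simp: near_def emb_def chart2_def chart_def)
  then have "q \<noteq> 0" "fst p = 1 / q" by (auto simp: pr_def split: if_splits)
  then have "fst p \<noteq> 0" "\<bar>q\<bar> * \<bar>fst p\<bar> = 1" by auto
  then show ?thesis using mult_strict_right_mono[OF q(1), of "\<bar>fst p\<bar>"] by simp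
qed

lemma basin_near_eq:
  "basin I g = {p. \<exists>U. open U \<and> p \<in> U \<and> (\<forall>n. \<forall>q\<in>U. iter_defined I g n (emb q)) \<and>
     (\<forall>e>0. \<forall>\<^sub>F n in sequentially. \<forall>q\<in>U. (g ^^ n) (emb q) \<in> near e)}"
proof -
  have "(\<forall>V. openin torus V \<and> (None, None) \<in> V \<longrightarrow>
      (\<forall>\<^sub>F n in sequentially. \<forall>q\<in>U. (g ^^ n) (emb q) \<in> V)) \<longleftrightarrow>
    (\<forall>e>0. \<forall>\<^sub>F n in sequentially. \<forall>q\<in>U. (g ^^ n) (emb q) \<in> near e)" (is "?L \<longleftrightarrow> ?R") for U
  proof
    assume ?R
    show ?L
    proof (intro allI impI)
      fix V assume "openin torus V \<and> (None, None) \<in> V"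
      then obtain e where "e > 0" "near e \<subseteq> V" using near_subset_nhd by blast
      then show "\<forall>\<^sub>F n in sequentially. \<forall>q\<in>U. (g ^^ n) (emb q) \<in> V"
        using \<open>?R\<close> by (auto elim!: eventually_mono allE[of _ e])
    qed
  qed (use openin_near infinity_in_near in blast)
  then show ?thesis unfolding basin_def by auto
qed

lemma basinI:
  assumes "open U" "p \<in> U" "\<And>n q. q \<in> U \<Longrightarrow> iter_defined I g n (emb q)"
    "\<And>e. e > 0 \<Longrightarrow> \<forall>\<^sub>F n in sequentially. \<forall>q\<in>U. (g ^^ n) (emb q) \<in> near e"
  shows "p \<in> basin I g"
  unfolding basin_near_eq using assms by blast

lemma basinE:
  assumes "p \<in> basin I g"
  obtains U where "open U" "p \<in> U" "\<And>n q. q \<in> U \<Longrightarrow> iter_defined I g n (emb q)"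
    "\<And>e. e > 0 \<Longrightarrow> \<forall>\<^sub>F n in sequentially. \<forall>q\<in>U. (g ^^ n) (emb q) \<in> near e"
  using assms unfolding basin_near_eq by blast

text \<open>The neighbourhood \<open>U\<close> of one point witnesses membership for all of its
  points.\<close>

lemma open_basin: "open (basin I g)"
  by (subst open_subopen) (unfold basin_def, blast)

lemma iter_defined_Suc:
  "iter_defined I g (Suc n) p \<longleftrightarrow> p \<notin> I \<and> iter_defined I g n (g p)"
  unfolding iter_defined_def All_less_Suc2 by (simp add: funpow_Suc_right del: funpow.simps(2))

text \<open>Where \<open>g\<close> is given by a continuous \<open>h\<close>, the preimage of a good
  neighbourhood is good: orbits only gain one initial point.\<close>

lemma basin_pullback:
  assumes D: "open D" "continuous_on D h" "p \<in> D"
    and g: "\<And>z. z \<in> D \<Longrightarrow> emb z \<notin> I \<and> g (emb z) = emb (h z)"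
    and p: "h p \<in> basin I g"
  shows "p \<in> basin I g"
proof -
  obtain U where U: "open U" "h p \<in> U" "\<And>n q. q \<in> U \<Longrightarrow> iter_defined I g n (emb q)"
    "\<And>e. e > 0 \<Longrightarrow> \<forall>\<^sub>F n in sequentially. \<forall>q\<in>U. (g ^^ n) (emb q) \<in> near e"
    using basinE[OF p] by blast
  show ?thesis
  proof (rule basinI[of "h -` U \<inter> D"])
    show "open (h -` U \<inter> D)" using D U(1) by (metis continuous_on_open_vimage)
    show "p \<in> h -` U \<inter> D" using D U by simp
    show "iter_defined I g n (emb q)" if "q \<in> h -` U \<inter> D" for n q
      using that g U(3) by (cases n) (auto simp: iter_defined_Suc, simp add: iter_defined_def)
    fix e :: real assume "e > 0"
    have "\<forall>\<^sub>F n in sequentially. \<forall>q\<in>h -` U \<inter> D. (g ^^ Suc n) (emb q) \<in> near e"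
      using U(4)[OF \<open>e > 0\<close>] by eventually_elim (auto simp: funpow_Suc_right g simp del: funpow.simps)
    then show "\<forall>\<^sub>F n in sequentially. \<forall>q\<in>h -` U \<inter> D. (g ^^ n) (emb q) \<in> near e"
      by (rule eventually_sequentially_Suc[THEN iffD1])
  qed
qed

text \<open>Here \<open>g\<close> undoes \<open>h\<close>, so the \<open>g\<close>-orbit of a point
  is that of its \<open>h\<close>-image with the first point dropped. This serves for
  \<open>g\<close> the inverse map and \<open>h = fmap a\<close>.\<close>

lemma basin_pushforward:
  assumes D: "open D" "continuous_on D h" "p \<in> D"
    and g: "\<And>z. z \<in> D \<Longrightarrow> g (emb (h z)) = emb z"
    and p: "h p \<in> basin I g"
  shows "p \<in> basin I g"
proof -
  obtain U where U: "open U" "h p \<in> U" "\<And>n q. q \<in> U \<Longrightarrow> iter_defined I g n (emb q)"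
    "\<And>e. e > 0 \<Longrightarrow> \<forall>\<^sub>F n in sequentially. \<forall>q\<in>U. (g ^^ n) (emb q) \<in> near e"
    using basinE[OF p] by blast
  show ?thesis
  proof (rule basinI[of "h -` U \<inter> D"])
    show "open (h -` U \<inter> D)" using D U(1) by (metis continuous_on_open_vimage)
    show "p \<in> h -` U \<inter> D" using D U by simp
    show "iter_defined I g n (emb q)" if "q \<in> h -` U \<inter> D" for n q
      using that g U(3)[of "h q" "Suc n"] by (auto simp: iter_defined_Suc)
    fix e :: real assume "e > 0"
    have "\<forall>\<^sub>F n in sequentially. \<forall>q\<in>U. (g ^^ Suc n) (emb q) \<in> near e"
      using U(4)[OF \<open>e > 0\<close>] by (rule eventually_sequentially_Suc[THEN iffD2])
    then show "\<forall>\<^sub>F n in sequentially. \<forall>q\<in>h -` U \<inter> D. (g ^^ n) (emb q) \<in> near e"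
    proof (eventually_elim, intro ballI)
      fix n q assume *: "\<forall>q\<in>U. (g ^^ Suc n) (emb q) \<in> near e" and "q \<in> h -` U \<inter> D"
      then have "(g ^^ Suc n) (emb (h q)) \<in> near e" "g (emb (h q)) = emb q" using g by auto
      then show "(g ^^ n) (emb q) \<in> near e" by (simp add: funpow_Suc_right del: funpow.simps)
    qed
  qed
qed

section \<open>The reversing symmetry\<close>

definition swapneg :: "real \<times> real \<Rightarrow> real \<times> real" where
  "swapneg p = (- snd p, - fst p)"

definition swapneg_ext :: "real option \<times> real option \<Rightarrow> real option \<times> real option" where
  "swapneg_ext p = (map_option uminus (snd p), map_option uminus (fst p))"

lemma swapneg_swapneg [simp]: "swapneg (swapneg p) = p"
  by (simp add: swapneg_def)

lemma swapneg_ext_swapneg_ext [simp]: "swapneg_ext (swapneg_ext p) = p"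
  by (simp add: swapneg_ext_def option.map_comp o_def prod_eq_iff option.map_ident)

lemma emb_swapneg: "emb (swapneg p) = swapneg_ext (emb p)"
  by (simp add: emb_def swapneg_def swapneg_ext_def)

lemma swapneg_ext_near: "p \<in> near e \<Longrightarrow> swapneg_ext p \<in> near e"
proof -
  assume "p \<in> near e"
  then obtain q r where "\<bar>q\<bar> < e" "\<bar>r\<bar> < e" "p = (pr 1 q, pr 1 r)"
    by (auto simp: near_def chart2_def chart_def)
  then show ?thesis
    by (intro nearI[of "- r" _ "- q"]) (auto simp: swapneg_ext_def pr_def)
qed

text \<open>The symmetry preserves every box \<open>near e\<close>. Orbits correspond as long as
  they avoid \<open>I\<close>, which holds on \<open>U\<close>.\<close>

lemma swapneg_basin:
  assumes conj: "\<And>z. z \<notin> I \<Longrightarrow> g' (swapneg_ext z) = swapneg_ext (g z)"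
    and I: "\<And>z. swapneg_ext z \<in> I' \<Longrightarrow> z \<in> I"
    and p: "p \<in> basin I g"
  shows "swapneg p \<in> basin I' g'"
proof -
  obtain U where U: "open U" "p \<in> U" "\<And>n q. q \<in> U \<Longrightarrow> iter_defined I g n (emb q)"
    "\<And>e. e > 0 \<Longrightarrow> \<forall>\<^sub>F n in sequentially. \<forall>q\<in>U. (g ^^ n) (emb q) \<in> near e"
    using basinE[OF p] by blast
  have it: "(g' ^^ n) (swapneg_ext z) = swapneg_ext ((g ^^ n) z)" if "iter_defined I g n z" for n z
    using that by (induction n) (auto simp: iter_defined_def conj)
  have it': "(g' ^^ n) (emb q) = swapneg_ext ((g ^^ n) (emb (swapneg q)))" if "swapneg q \<in> U" for n q
    using it[OF U(3)[OF that]] by (simp add: emb_swapneg)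
  show ?thesis
  proof (rule basinI[of "swapneg -` U"])
    have "continuous_on UNIV swapneg" unfolding swapneg_def by (intro continuous_intros)
    then show "open (swapneg -` U)" using U(1) by (metis continuous_on_open_vimage open_UNIV inf_top_right)
    show "swapneg p \<in> swapneg -` U" using U by simp
    show "iter_defined I' g' n (emb q)" if "q \<in> swapneg -` U" for n q
      unfolding iter_defined_def
    proof (intro allI impI notI)
      fix k assume "k < n" "(g' ^^ k) (emb q) \<in> I'"
      then have "(g ^^ k) (emb (swapneg q)) \<in> I" using it'[of q k] that I by simp
      then show False
        using \<open>k < n\<close> that U(3)[of "swapneg q" n] by (auto simp: iter_defined_def)
    qed
    show "\<forall>\<^sub>F n in sequentially. \<forall>q\<in>swapneg -` U. (g' ^^ n) (emb q) \<in> near e" if "e > 0" for e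
      using U(4)[OF that] by eventually_elim (auto simp: it' swapneg_ext_near)
  qed
qed

text \<open>The identity holds even at the indeterminacy points, where both sides take the default
  value \<open>pr 0 0 = None\<close>.\<close>

lemma Finvx_swapneg: "Finvx a (swapneg_ext z) = swapneg_ext (Fx a z)"
proof -
  have neg: "map_option uminus (pr p q) = pr (- p) q" for p q
    by (simp add: pr_def)
  obtain x y where z: "z = (x, y)" by fastforce
  have h: "hcoord (map_option uminus w) = (case w of None \<Rightarrow> (1, 0) | Some x \<Rightarrow> (- x, 1))" for w
    by (cases w) (simp_all add: hcoord_def)
  show ?thesis
  proof (cases x)
    case None
    then show ?thesis
      by (cases y) (simp_all add: z h Finvx_def Fx_def swapneg_ext_def hcoord_def pr_def)
  next
    case (Some s)
    show ?thesis
    proof (cases y)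
      case None
      then show ?thesis using Some
        by (simp add: z h Finvx_def Fx_def swapneg_ext_def hcoord_def pr_def)
    next
      case (Some t)
      have "pr (- t * (- s - a)) (1 - s) = pr (- (t * (s + a))) (s - 1)"
        by (rule pr_scale'[of "- 1"]) (simp_all add: algebra_simps)
      then show ?thesis using Some \<open>x = Some s\<close>
        by (simp add: z h Finvx_def Fx_def swapneg_ext_def hcoord_def neg)
    qed
  qed
qed

lemma swapneg_indet:
  "swapneg_ext z \<in> indet_finv a \<longleftrightarrow> z \<in> indet_f a"
  by (cases z; cases "fst z"; cases "snd z")
     (auto simp: indet_f_def indet_finv_def swapneg_ext_def)

lemma finv_ext_swapneg:
  assumes "a > 1" "z \<notin> indet_f a"
  shows "finv_ext a (swapneg_ext z) = swapneg_ext (f_ext a z)"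
  using assms swapneg_indet[of z a] by (simp add: f_ext_eq finv_ext_eq Finvx_swapneg)

lemma f_ext_swapneg:
  assumes "a > 1" "z \<notin> indet_finv a"
  shows "f_ext a (swapneg_ext z) = swapneg_ext (finv_ext a z)"
proof -
  have "swapneg_ext z \<notin> indet_f a"
    using assms(2) swapneg_indet[of "swapneg_ext z" a] by simp
  then show ?thesis
    using finv_ext_swapneg[OF assms(1), of "swapneg_ext z"] by (metis swapneg_ext_swapneg_ext)
qed

lemma swapneg_Bplus_iff:
  assumes "a > 1"
  shows "swapneg p \<in> Bplus a \<longleftrightarrow> p \<in> Bminus a"
proof
  assume "swapneg p \<in> Bplus a"
  then have "swapneg (swapneg p) \<in> Bminus a"
    unfolding Bplus_def Bminus_def
    by (rule swapneg_basin[rotated 2]) (use assms in \<open>auto simp: finv_ext_swapneg swapneg_indet\<close>)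
  then show "p \<in> Bminus a" by simp
next
  assume "p \<in> Bminus a"
  then show "swapneg p \<in> Bplus a"
    unfolding Bplus_def Bminus_def
    by (rule swapneg_basin[rotated 2])
       (use assms in \<open>auto simp: f_ext_swapneg swapneg_indet[symmetric]\<close>)
qed

lemma swapneg_Bminus_iff:
  assumes "a > 1"
  shows "swapneg p \<in> Bminus a \<longleftrightarrow> p \<in> Bplus a"
  using swapneg_Bplus_iff[OF assms, of "swapneg p"] by simp

section \<open>A trapping region at infinity\<close>

text \<open>With \<open>q = 1 / x\<close>, the region consists of the points with \<open>x > 1\<close>, \<open>y > 0\<close>, those with
  \<open>x < - a\<close>, \<open>0 < y < 1 - x\<close>, and those with \<open>x = \<infinity>\<close>, \<open>0 < y < \<infinity>\<close>. It is
  invariant under the second iterate, which becomes \<open>step\<close> in the coordinates \<open>(q, y)\<close>; the first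
  iterate is the point with coordinates \<open>(mid a q y, 1 / rec a q)\<close>.\<close>

definition trapped :: "real \<Rightarrow> real \<Rightarrow> real \<Rightarrow> bool" where
  "trapped a q y \<longleftrightarrow> 1 + a * q > 0 \<and> q < 1 \<and> y > 0 \<and> q * (y - 1) > - 1"

definition mid :: "real \<Rightarrow> real \<Rightarrow> real \<Rightarrow> real" where
  "mid a q y = y * (1 + a * q) / (1 - q)"

definition rec :: "real \<Rightarrow> real \<Rightarrow> real" where
  "rec a q = q / (1 + (a - 1) * q)"

definition step :: "real \<Rightarrow> real \<times> real \<Rightarrow> real \<times> real" where
  "step a = (\<lambda>(q, y). (rec a q * (mid a q y - 1) / (mid a q y + a), mid a q y + a - 1))"

definition trap :: "real \<Rightarrow> (real option \<times> real option) set" where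
  "trap a = {(pr 1 q, Some y) | q y. trapped a q y}"

text \<open>Half the smaller of two growths of \<open>1 / \<bar>q\<bar>\<close> in one step: at
  least \<open>a - 1\<close> from \<open>q > 0\<close>, at least \<open>2\<close> when
  \<open>q\<close> stays negative.\<close>

definition rate :: "real \<Rightarrow> real" where
  "rate a = min 1 ((a - 1) / 2)"

text \<open>For \<open>q = - 1 / u\<close> a step first costs \<open>y\<close> the amount
  \<open>(a + 1) * y / (u + 1)\<close>, then adds \<open>a - 1\<close>. At
  \<open>y = gain a * (u + 1)\<close> the cost is half of what is added.\<close>

definition gain :: "real \<Rightarrow> real" where
  "gain a = (a - 1) / (2 * (a + 1))"

text \<open>The reciprocal \<open>1 / \<bar>q\<bar>\<close> grows by \<open>2 * rate a\<close> in every step except those from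
  \<open>q < 0\<close> to \<open>q > 0\<close>, where it does not decrease; the two different bounds absorb these steps.\<close>

definition decayed :: "real \<Rightarrow> nat \<Rightarrow> real \<Rightarrow> bool" where
  "decayed a n q \<longleftrightarrow> (q > 0 \<longrightarrow> rate a * n \<le> 1 / q) \<and> (q < 0 \<longrightarrow> rate a * (n + 1) \<le> - 1 / q)"

section \<open>Invariance and growth in the coordinates \<open>(q, y)\<close>\<close>

lemma mid_pos: "trapped a q y \<Longrightarrow> mid a q y > 0"
  by (simp add: trapped_def mid_def)

lemma rate_bounds: "a > 1 \<Longrightarrow> 0 < rate a \<and> rate a \<le> 1 \<and> 2 * rate a \<le> a - 1"
  by (auto simp: rate_def min_def)

text \<open>On the branch \<open>x < - a\<close> all is expressed through \<open>u = - x\<close>.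
  Multiplying \<open>y < u + 1\<close> by \<open>(u - a) / (u + 1)\<close> bounds
  \<open>mid\<close>.\<close>

lemma trapped_neg_coords:
  assumes "a > 1" "trapped a q y" "q < 0" "u = - 1 / q"
  shows "u > a" "q = - 1 / u" "y < u + 1" "rec a q = - 1 / (u + 1 - a)"
    "mid a q y = y * (u - a) / (u + 1)" "mid a q y < u - a"
proof -
  show u: "q = - 1 / u" using assms by simp
  have "u > 0" using assms by simp
  show ua: "u > a" using assms(2) \<open>u > 0\<close> unfolding trapped_def u by (simp add: field_simps)
  show y: "y < u + 1" using assms(2) \<open>u > 0\<close> unfolding trapped_def u by (simp add: field_simps)
  show "rec a q = - 1 / (u + 1 - a)"
    using ua assms(1) unfolding rec_def u by (simp add: field_simps)
  show m: "mid a q y = y * (u - a) / (u + 1)"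
  proof -
    have "1 + a * q = (u - a) / u" "1 - q = (u + 1) / u"
      using \<open>u > 0\<close> unfolding u by (simp_all add: field_simps)
    then show ?thesis using \<open>u > 0\<close> unfolding mid_def by simp
  qed
  have "y * (u - a) < (u + 1) * (u - a)" using y ua by simp
  then show "mid a q y < u - a" using \<open>u > 0\<close> unfolding m by (simp add: field_simps)
qed

lemma trapped_pos_coords:
  assumes "a > 1" "trapped a q y" "q > 0" "x = 1 / q"
  shows "x > 1" "q = 1 / x" "rec a q = 1 / (x + a - 1)"
proof -
  show x: "q = 1 / x" using assms by simp
  show "x > 1" using assms by (simp add: trapped_def)
  then show "rec a q = 1 / (x + a - 1)"
    using assms(1) unfolding rec_def x by (simp add: field_simps)
qed

lemma mid_ge:
  assumes "a > 1" "trapped a q y" "q \<ge> 0"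
  shows "mid a q y \<ge> y"
proof -
  have "y * (1 - q) \<le> y * (1 + a * q)"
  proof (intro mult_left_mono)
    have "0 \<le> a * q" using assms by simp
    then show "1 - q \<le> 1 + a * q" using assms(3) by linarith
  qed (use assms in \<open>simp add: trapped_def\<close>)
  then show ?thesis using assms by (simp add: mid_def trapped_def field_simps)
qed

text \<open>The sign of \<open>q'\<close> is that of \<open>rec a q * (s - 1)\<close>, so the cases
  are the sign of \<open>q\<close> and the position of \<open>s\<close> relative to
  \<open>1\<close>.\<close>

lemma step_trapped_decayed:
  assumes a: "a > 1" and t: "trapped a q y" and d: "decayed a n q"
    and st: "step a (q, y) = (q', y')"
  shows "trapped a q' y' \<and> decayed a (Suc n) q'"
proof -
  define s where "s = mid a q y"
  define r where "r = rec a q"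
  note k = rate_bounds[OF a]
  have s: "s > 0" using mid_pos[OF t] by (simp add: s_def)
  have q': "q' = r * (s - 1) / (s + a)" and y': "y' = s + a - 1"
    using st by (auto simp: step_def s_def r_def)
  have y'_pos: "y' > 0" using s a y' by simp
  consider "q = 0" | "q > 0" | "q < 0" by linarith
  then show ?thesis
  proof cases
    case 1
    then show ?thesis using y'_pos q' by (simp add: r_def rec_def trapped_def decayed_def)
  next
    case 2
    define x where "x = 1 / q"
    note x = trapped_pos_coords[OF a t 2 x_def]
    \<comment> \<open>\<open>w\<close> is \<open>1 / rec a q\<close>, the second coordinate of the
      first iterate.\<close>
    define w where "w = x + a - 1"
    have w: "w > a" using x by (simp add: w_def)
    have q'': "q' = (s - 1) / (w * (s + a))" using x(3) by (simp add: q' r_def w_def)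
    have p: "w * (s + a) > 0" using w s a by simp
    \<comment> \<open>A negative \<open>q'\<close> raises the demand from \<open>n\<close> to
      \<open>n + 2\<close>; the increase \<open>w - x = a - 1\<close> pays for it.\<close>
    have wn: "rate a * (n + 2) \<le> w"
      using d k 2 by (simp add: decayed_def x_def w_def algebra_simps)
    have up: "s - 1 < s + a" "1 - s < s + a" using a s by auto
    show ?thesis
    proof (cases "s \<ge> 1")
      case True
      have "s + a \<le> w * (s + a)" using mult_right_mono[of 1 w "s + a"] w s a by simp
      then have "s - 1 < w * (s + a)" using up by linarith
      then have "q' < 1" using p by (simp add: q'')
      have "q' \<ge> 0" using True p by (simp add: q'')
      have "rate a * (n + 1) \<le> 1 / q'" if "q' > 0"
      proof -
        have "s > 1" using that True by (cases "s = 1") (auto simp: q'')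
        have "w * (s - 1) \<le> w * (s + a)" using up w a by (intro mult_left_mono) auto
        then have "w \<le> 1 / q'" using \<open>s > 1\<close> by (simp add: q'' field_simps)
        then show ?thesis using wn k by (simp add: algebra_simps)
      qed
      moreover have "q' * (y' - 1) > - 1"
        using \<open>q' \<ge> 0\<close> \<open>q' < 1\<close> y'_pos
        by (smt (verit) mult_less_cancel_left1 mult_nonneg_nonneg mult_left_le_one_le mult_minus_right)
      ultimately show ?thesis
        using \<open>q' \<ge> 0\<close> \<open>q' < 1\<close> y'_pos a by (simp add: trapped_def decayed_def algebra_simps add_pos_nonneg)
    next
      case False
      define u where "u = w * (s + a) / (1 - s)"
      have q_u: "q' = - 1 / u" using False p by (simp add: q'' u_def field_simps)
      have "a * (1 - s) \<le> s + a" using s a by (simp add: algebra_simps)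
      then have "w * (a * (1 - s)) \<le> w * (s + a)" using w a by (intro mult_left_mono) auto
      then have "u \<ge> a * w" using False by (simp add: u_def field_simps)
      have "a * w > a" "a * w > w" using w a by auto
      then have "u > a" "u > w" using \<open>u \<ge> a * w\<close> by auto
      have "y' < u + 1" using False y' \<open>u > a\<close> by simp
      then show ?thesis
        using \<open>u > a\<close> \<open>u > w\<close> wn y'_pos a
        by (auto simp: trapped_def decayed_def q_u field_simps)
    qed
  next
    case 3
    define u where "u = - 1 / q"
    note u = trapped_neg_coords[OF a t 3 u_def]
    define w where "w = u + 1 - a"
    \<comment> \<open>Now \<open>w\<close> is \<open>- 1 / rec a q\<close>, and the first inequality
      restates \<open>mid a q y < u - a\<close>.\<close>
    have w: "w > s + 1" "w > 1" using u by (auto simp: w_def s_def)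
    have "q' = - ((s - 1) / (w * (s + a)))" using u(4) by (simp add: q' r_def w_def)
    then have q'': "q' = (1 - s) / (w * (s + a))" by (metis minus_diff_eq minus_divide_left)
    have p: "w * (s + a) > 0" using w s a by simp
    have un: "rate a * (n + 1) \<le> u" using d 3 by (simp add: decayed_def u_def)
    show ?thesis
    proof (cases "s < 1")
      case True
      have "a * (1 - s) \<le> s + a" using s a by (simp add: algebra_simps)
      then have "w * (a * (1 - s)) \<le> w * (s + a)" using w by (intro mult_left_mono) auto
      then have "a * w \<le> 1 / q'" using True p by (simp add: q'' field_simps)
      \<comment> \<open>No growth is available here, but none is required: \<open>decayed\<close>
        already asks for \<open>n + 1\<close> at negative \<open>q\<close>.\<close>
      moreover have "a * w - u = (a - 1) * (u - a)" by (simp add: w_def algebra_simps)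
      moreover have "(a - 1) * (u - a) > 0" using u a by simp
      ultimately have "u \<le> 1 / q'" by linarith
      have "q' > 0" using True p by (simp add: q'')
      moreover have "q' < 1"
        using \<open>u \<le> 1 / q'\<close> u a \<open>q' > 0\<close> by (smt (verit) le_divide_eq_1 less_divide_eq_1_pos)
      moreover have "q' * (y' - 1) > - 1"
        using \<open>q' > 0\<close> \<open>q' < 1\<close> y'_pos
        by (smt (verit) mult_less_cancel_left1 mult_nonneg_nonneg mult_left_le_one_le mult_minus_right)
      ultimately show ?thesis
        using \<open>u \<le> 1 / q'\<close> un y'_pos a by (simp add: trapped_def decayed_def algebra_simps add_pos_nonneg)
    next
      case False
      show ?thesis
      proof (cases "s = 1")
        case True
        then show ?thesis using y'_pos q' by (simp add: trapped_def decayed_def)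
      next
        case False
        with \<open>\<not> s < 1\<close> have "s > 1" by simp
        define v where "v = w * (s + a) / (s - 1)"
        have q_v: "q' = - 1 / v" using \<open>s > 1\<close> p by (simp add: q'' v_def field_simps)
        have "(s - 1) * (u + 2) \<le> w * (s + a)"
        proof -
          \<comment> \<open>The last factor is \<open>w + 1 - s\<close>, positive by
            \<open>w > s + 1\<close>.\<close>
          have "w * (s + a) - (s - 1) * (u + 2) = (a + 1) * (u + 2 - a - s)"
            by (simp add: w_def algebra_simps)
          moreover have "(a + 1) * (u + 2 - a - s) \<ge> 0" using w a by (simp add: w_def)
          ultimately show ?thesis by linarith
        qed
        then have "v \<ge> u + 2" using \<open>s > 1\<close> by (simp add: v_def field_simps)
        have "(s - 1) * (s + a) \<le> w * (s + a)" using w s a by (intro mult_right_mono) auto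
        then have "v \<ge> s + a" using \<open>s > 1\<close> by (simp add: v_def field_simps)
        then have "y' < v + 1" using y' by simp
        then show ?thesis
          using \<open>v \<ge> u + 2\<close> u(1) un k y'_pos a
          by (auto simp: trapped_def decayed_def q_v field_simps)
      qed
    qed
  qed
qed

text \<open>For \<open>q \<ge> 0\<close> the map \<open>mid\<close> does not lower \<open>y\<close>.
  For \<open>q < 0\<close> either the loss is at most half of the added \<open>a - 1\<close>, or
  \<open>y\<close> is already comparable to \<open>u\<close>, which is bounded below linearly in
  \<open>n\<close>.\<close>

lemma step_gain:
  assumes a: "a > 1" and t: "trapped a q y" and d: "decayed a n q"
    and st: "step a (q, y) = (q', y')"
  shows "y' \<ge> min (y + (a - 1) / 2) (gain a * (rate a * (n + 1) - a))"
proof (cases "q < 0")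
  case False
  then have "y' \<ge> y + (a - 1) / 2" using mid_ge[OF a t] st a by (auto simp: step_def field_simps)
  then show ?thesis by simp
next
  case True
  define u where "u = - 1 / q"
  note u = trapped_neg_coords[OF a t True u_def]
  have un: "rate a * (n + 1) \<le> u" using d True by (simp add: decayed_def u_def)
  have y': "y' = y * (u - a) / (u + 1) + a - 1" using st u(5) by (simp add: step_def)
  show ?thesis
  proof (cases "y \<le> gain a * (u + 1)")
    case True
    have "(a + 1) * y \<le> (a + 1) * (gain a * (u + 1))" using True a by simp
    also have "\<dots> = ((a + 1) * gain a) * (u + 1)" by simp
    also have "(a + 1) * gain a = (a - 1) / 2" using a by (simp add: gain_def field_simps)
    finally have "(a + 1) * y / (u + 1) \<le> (a - 1) / 2" using u a by (simp add: pos_divide_le_eq)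
    moreover have "y * (u - a) / (u + 1) = y - (a + 1) * y / (u + 1)" using u a by (simp add: field_simps)
    ultimately have "y' \<ge> y + (a - 1) / 2" using y' by argo
    then show ?thesis by simp
  next
    case False
    have "gain a * (u + 1) * (u - a) \<le> y * (u - a)" using False u by (intro mult_right_mono) auto
    then have "gain a * (u - a) \<le> y * (u - a) / (u + 1)" using u a by (simp add: field_simps)
    moreover have "gain a * (rate a * (n + 1) - a) \<le> gain a * (u - a)"
      using un a by (intro mult_left_mono) (auto simp: gain_def)
    ultimately show ?thesis using y' a by simp
  qed
qed

lemma step_iterates:
  assumes a: "a > 1" and t: "trapped a q y" and it: "(step a ^^ n) (q, y) = (q', y')"
  shows "trapped a q' y' \<and> decayed a n q' \<and> y' \<ge> gain a * (rate a * n - a)"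
  using it
proof (induction n arbitrary: q' y')
  case 0
  have "decayed a 0 q"
  proof -
    have "rate a \<le> - 1 / q" if "q < 0"
      using trapped_neg_coords(1)[OF a t that refl] rate_bounds[OF a] a by simp
    then show ?thesis by (simp add: decayed_def)
  qed
  moreover have "gain a * a > 0" "y > 0" using a t by (auto simp: gain_def trapped_def)
  ultimately show ?case using 0 t by (simp add: mult.commute)
next
  case (Suc n)
  obtain q1 y1 where 1: "(step a ^^ n) (q, y) = (q1, y1)" by fastforce
  note IH = Suc.IH[OF 1]
  have st: "step a (q1, y1) = (q', y')" using Suc.prems 1 by simp
  \<comment> \<open>The linear bound rises per step by no more than the first alternative of
    \<open>step_gain\<close> provides.\<close>
  have "gain a * rate a \<le> 1 * ((a - 1) / 2)"
    using rate_bounds[OF a] a by (intro mult_mono) (auto simp: gain_def field_simps)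
  moreover have "gain a * (rate a * (n + 1) - a) = gain a * (rate a * n - a) + gain a * rate a"
    by (simp add: algebra_simps)
  ultimately have "gain a * (rate a * (n + 1) - a) \<le> y1 + (a - 1) / 2"
    using IH by linarith
  then have "gain a * (rate a * (n + 1) - a) \<le> y'"
    using step_gain[OF a _ _ st, of n] IH by linarith
  then show ?case
    using step_trapped_decayed[OF a _ _ st, of n] IH by (simp add: add.commute)
qed

section \<open>The extended map on the trapping region\<close>

lemma f_ext_trap:
  assumes a: "a > 1" and t: "trapped a q y"
  shows "(pr 1 q, Some y) \<notin> indet_f a"
    and "f_ext a (pr 1 q, Some y) = (Some (mid a q y), pr 1 (rec a q))"
    and "(Some (mid a q y), pr 1 (rec a q)) \<notin> indet_f a"
    and "f_ext a (Some (mid a q y), pr 1 (rec a q)) = (pr 1 (fst (step a (q, y))), Some (snd (step a (q, y))))"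
proof -
  have s: "mid a q y > 0" by (rule mid_pos[OF t])
  have d: "1 + (a - 1) * q > 0"
  proof (cases "q \<ge> 0")
    case False
    then have "a * q \<le> (a - 1) * q" by (simp add: algebra_simps)
    then show ?thesis using t by (simp add: trapped_def)
  qed (use a in \<open>simp add: add_pos_nonneg\<close>)
  show 1: "(pr 1 q, Some y) \<notin> indet_f a"
    using t by (auto simp: indet_f_def pr_def trapped_def split: if_splits)
  show 2: "(Some (mid a q y), pr 1 (rec a q)) \<notin> indet_f a"
    using s a by (auto simp: indet_f_def pr_def split: if_splits)
  have "Fx a (chart2 True False (q, y)) = (pr (y * (1 + a * q)) (1 * (1 - q)), pr (1 + (a - 1) * q) q)"
    by (rule Fx_chart) (simp_all add: hv_def)
  moreover have "pr (1 + (a - 1) * q) q = pr 1 (rec a q)"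
    using d by (simp add: pr_def rec_def)
  ultimately show "f_ext a (pr 1 q, Some y) = (Some (mid a q y), pr 1 (rec a q))"
    using 1 t by (simp add: f_ext_eq[OF a] chart2_def chart_def pr_def mid_def trapped_def)
  have "Fx a (chart2 False True (mid a q y, rec a q)) =
      (pr (1 * (mid a q y + a * 1)) (rec a q * (mid a q y - 1)), pr (mid a q y + (a - 1) * 1) 1)"
    by (rule Fx_chart) (simp_all add: hv_def)
  moreover have "pr (mid a q y + a) (rec a q * (mid a q y - 1)) = pr 1 (fst (step a (q, y)))"
    using s a by (simp add: pr_def step_def)
  ultimately show "f_ext a (Some (mid a q y), pr 1 (rec a q)) = (pr 1 (fst (step a (q, y))), Some (snd (step a (q, y))))"
    using 2 by (simp add: f_ext_eq[OF a] chart2_def chart_def pr_def step_def)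
qed

lemma f_ext_trap_iterates:
  assumes a: "a > 1" and t: "trapped a q y"
  shows "(f_ext a ^^ (2 * n)) (pr 1 q, Some y) =
    (pr 1 (fst ((step a ^^ n) (q, y))), Some (snd ((step a ^^ n) (q, y))))"
proof (induction n)
  case (Suc n)
  obtain q' y' where z: "(step a ^^ n) (q, y) = (q', y')" by fastforce
  have t': "trapped a q' y'" using step_iterates[OF a t z] by simp
  show ?case using Suc f_ext_trap[OF a t'] by (simp add: z)
qed simp

lemma trap_iter_defined:
  assumes a: "a > 1" and P: "P \<in> trap a"
  shows "iter_defined (indet_f a) (f_ext a) n P"
  unfolding iter_defined_def
proof (intro allI impI)
  fix k
  obtain q y where qy: "P = (pr 1 q, Some y)" "trapped a q y"
    using P by (auto simp: trap_def)
  obtain q' y' where z: "(step a ^^ (k div 2)) (q, y) = (q', y')" by fastforce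
  have t': "trapped a q' y'" using step_iterates[OF a qy(2) z] by simp
  have ev: "(f_ext a ^^ (2 * (k div 2))) P = (pr 1 q', Some y')"
    using f_ext_trap_iterates[OF a qy(2), of "k div 2"] z qy(1) by simp
  show "(f_ext a ^^ k) P \<notin> indet_f a"
  proof (cases "even k")
    case True
    then show ?thesis using ev f_ext_trap(1)[OF a t'] by simp
  next
    case False
    then have "k = Suc (2 * (k div 2))" by simp
    then have "(f_ext a ^^ k) P = f_ext a ((f_ext a ^^ (2 * (k div 2))) P)"
      by (metis comp_apply funpow.simps(2))
    then show ?thesis using ev f_ext_trap(2,3)[OF a t'] by simp
  qed
qed

text \<open>The bounds of \<open>step_iterates\<close> depend only on \<open>a\<close> and the
  number of steps, so one \<open>N\<close> serves the whole region. Odd times are treated through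
  the intermediate point.\<close>

lemma trap_converges:
  assumes a: "a > 1" and e: "e > 0"
  shows "\<forall>\<^sub>F n in sequentially. \<forall>P\<in>trap a. (f_ext a ^^ n) P \<in> near e"
proof -
  have pos: "rate a > 0" "gain a > 0" using a by (simp_all add: rate_def gain_def)
  \<comment> \<open>The first bound makes \<open>y'\<close> large, with a summand \<open>a\<close>
    to absorb \<open>y'' = mid a q' y' + a - 1\<close> at odd times. The second makes
    \<open>a * \<bar>q'\<bar> < e\<close>, where the factor \<open>a\<close> absorbs the passage
    from \<open>q'\<close> to \<open>rec a q'\<close>.\<close>
  obtain N :: nat where N: "N > ((1 / e + a) / gain a + a) / rate a" "N > a / e / rate a"
  proof -
    obtain N :: nat where "N > max (((1 / e + a) / gain a + a) / rate a) (a / e / rate a)"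
      using reals_Archimedean2 by blast
    then show ?thesis using that[of N] unfolding max_less_iff_conj by blast
  qed
  have "(f_ext a ^^ k) P \<in> near e" if k: "k \<ge> 2 * N" and P: "P \<in> trap a" for k P
  proof -
    obtain q y where qy: "P = (pr 1 q, Some y)" "trapped a q y"
      using P by (auto simp: trap_def)
    define m where "m = k div 2"
    have m: "m \<ge> N" using k by (simp add: m_def)
    obtain q' y' where z: "(step a ^^ m) (q, y) = (q', y')" by fastforce
    note S = step_iterates[OF a qy(2) z]
    then have t': "trapped a q' y'" by simp
    have ev: "(f_ext a ^^ (2 * m)) P = (pr 1 q', Some y')"
      using f_ext_trap_iterates[OF a qy(2), of m] z qy(1) by simp
    have rm: "rate a * N \<le> rate a * m" using m pos by simp
    have Nr: "a / e < rate a * N" "(1 / e + a) / gain a + a < rate a * N"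
      using mult_strict_right_mono[OF N(1) pos(1)] mult_strict_right_mono[OF N(2) pos(1)] pos(1)
      by (simp_all add: mult.commute)
    have q_small: "a * \<bar>q'\<bar> < e"
    proof (cases "q' = 0")
      case False
      then have "rate a * m \<le> 1 / \<bar>q'\<bar>" using S pos
        by (cases "q' > 0") (auto simp: decayed_def algebra_simps)
      then have "a / e < 1 / \<bar>q'\<bar>" using Nr rm by linarith
      then show ?thesis using False e by (simp add: field_simps)
    qed (use e in simp)
    have y_large: "1 / e + a < gain a * (rate a * m - a)"
    proof -
      have "(1 / e + a) / gain a < rate a * m - a" using Nr rm by linarith
      then show ?thesis using pos by (simp add: pos_divide_less_eq mult.commute)
    qed
    have inv_small: "pr 1 (1 / u) = Some u \<and> \<bar>1 / u\<bar> < e" if "u > 1 / e" for u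
    proof -
      have "0 < 1 / e" using e by simp
      then have "u > 0" using that by linarith
      then show ?thesis using that e by (simp add: pr_def field_simps)
    qed
    show ?thesis
    proof (cases "even k")
      case True
      have "\<bar>q'\<bar> \<le> a * \<bar>q'\<bar>" using a mult_right_mono[of 1 a "\<bar>q'\<bar>"] by simp
      then have "\<bar>q'\<bar> < e" using q_small by simp
      moreover have "y' > 1 / e" using S y_large a by linarith
      ultimately show ?thesis
        using True ev inv_small[of y'] by (intro nearI[of q' _ "1 / y'"]) (auto simp: m_def)
    next
      case False
      obtain q'' y'' where st: "step a (q', y') = (q'', y'')" by fastforce
      then have "(step a ^^ Suc m) (q, y) = (q'', y'')" using z by simp
      then have "gain a * (rate a * Suc m - a) \<le> y''" using step_iterates[OF a qy(2)] by blast
      moreover have "gain a * (rate a * m - a) \<le> gain a * (rate a * Suc m - a)"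
        using pos by (intro mult_left_mono) auto
      ultimately have "mid a q' y' > 1 / e" using st y_large by (simp add: step_def)
      moreover have "\<bar>rec a q'\<bar> < e"
      proof -
        define d where "d = 1 + (a - 1) * q'"
        \<comment> \<open>By \<open>1 + a * q' > 0\<close> the denominator of \<open>rec\<close> is
          at least \<open>1 / a\<close>.\<close>
        have "(a - 1) * (a * q') \<ge> (a - 1) * (- 1)"
          using t' a by (intro mult_left_mono) (auto simp: trapped_def)
        then have "a * d \<ge> 1" by (simp add: d_def algebra_simps)
        then have "d > 0" using a by (smt (verit) mult_nonneg_nonpos)
        have "\<bar>q'\<bar> \<le> \<bar>q'\<bar> * (a * d)" using \<open>a * d \<ge> 1\<close> mult_left_mono[of 1 "a * d" "\<bar>q'\<bar>"] by simp
        moreover have "\<bar>rec a q'\<bar> = \<bar>q'\<bar> / d" using \<open>d > 0\<close> by (simp add: rec_def d_def)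
        ultimately have "\<bar>rec a q'\<bar> \<le> a * \<bar>q'\<bar>"
          using \<open>d > 0\<close> by (simp add: pos_divide_le_eq mult_ac)
        then show ?thesis using q_small by simp
      qed
      moreover have "(f_ext a ^^ k) P = (Some (mid a q' y'), pr 1 (rec a q'))"
      proof -
        have "k = Suc (2 * m)" using False by (simp add: m_def)
        then show ?thesis using ev f_ext_trap(2)[OF a t'] by simp
      qed
      ultimately show ?thesis
        using inv_small[of "mid a q' y'"] by (intro nearI[of "1 / mid a q' y'" _ "rec a q'"]) auto
    qed
  qed
  then show ?thesis unfolding eventually_sequentially by blast
qed

section \<open>The basins cover the complement of the square\<close>

text \<open>The finite points of \<open>trap a\<close>.\<close>

definition escape :: "real \<Rightarrow> (real \<times> real) set" where
  "escape a = {(x, y). 1 < x \<and> 0 < y \<or> x < - a \<and> 0 < y \<and> y < 1 - x}"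

lemma escape_trap:
  assumes "a > 1" "p \<in> escape a"
  shows "emb p \<in> trap a"
proof -
  obtain x y where p: "p = (x, y)" by fastforce
  have "x \<noteq> 0" using assms by (auto simp: p escape_def)
  then have "emb p = (pr 1 (1 / x), Some y)" by (simp add: p emb_def pr_def)
  moreover have "trapped a (1 / x) y"
    using assms by (auto simp: p escape_def trapped_def field_simps)
  ultimately show ?thesis by (auto simp: trap_def)
qed

lemma f_ext_emb:
  assumes "a > 1" "x \<noteq> 1"
  shows "emb (x, y) \<notin> indet_f a" "f_ext a (emb (x, y)) = emb (fmap a (x, y))"
proof -
  show "emb (x, y) \<notin> indet_f a" using assms by (simp add: emb_def indet_f_def)
  show "f_ext a (emb (x, y)) = emb (fmap a (x, y))"
    using is_cont_ext_Fx[OF assms(1)] assms by (simp add: f_ext_eq is_cont_ext_def)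
qed

lemma finv_ext_emb:
  assumes "a > 1" "y \<noteq> - 1"
  shows "finv_ext a (emb (x, y)) = emb (finv a (x, y))"
  using is_cont_ext_Finvx[OF assms(1)] assms by (simp add: finv_ext_eq is_cont_ext_def)

lemma continuous_on_fmap: "continuous_on {z. fst z \<noteq> 1} (fmap a)"
  unfolding fmap_def case_prod_beta by (intro continuous_intros) auto

lemma open_fst_neq: "open {z :: real \<times> real. fst z \<noteq> c}"
  by (intro open_Collect_neq continuous_intros)

lemma Bplus_pullback:
  assumes "a > 1" "x \<noteq> 1" "fmap a (x, y) \<in> Bplus a"
  shows "(x, y) \<in> Bplus a"
  unfolding Bplus_def
proof (rule basin_pullback[OF open_fst_neq continuous_on_fmap])
  fix z :: "real \<times> real" assume "z \<in> {z. fst z \<noteq> 1}"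
  then show "emb z \<notin> indet_f a \<and> f_ext a (emb z) = emb (fmap a z)"
    using f_ext_emb[OF assms(1), of "fst z" "snd z"] by simp
qed (use assms in \<open>simp_all add: Bplus_def\<close>)

text \<open>\<open>finv a\<close> undoes \<open>fmap a\<close> off the line \<open>x = - a\<close>,
  which is collapsed to the indeterminacy point \<open>(0, - 1)\<close>.\<close>

lemma Bminus_pushforward:
  assumes "a > 1" "x \<noteq> 1" "x \<noteq> - a" "fmap a (x, y) \<in> Bminus a"
  shows "(x, y) \<in> Bminus a"
  unfolding Bminus_def
proof (rule basin_pushforward[where D = "{z. fst z \<noteq> 1} \<inter> {z. fst z \<noteq> - a}" and h = "fmap a"])
  show "continuous_on ({z. fst z \<noteq> 1} \<inter> {z. fst z \<noteq> - a}) (fmap a)"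
    by (rule continuous_on_subset[OF continuous_on_fmap]) auto
  fix z assume "z \<in> {z. fst z \<noteq> 1} \<inter> {z :: real \<times> real. fst z \<noteq> - a}"
  then obtain s t where z: "z = (s, t)" "s \<noteq> 1" "s \<noteq> - a" by (cases z) auto
  then have "s + a \<noteq> 0" by linarith
  then show "finv_ext a (emb (fmap a z)) = emb z"
    using z assms(1) by (simp add: fmap_def finv_ext_emb) (simp add: finv_def)
qed (use assms in \<open>auto simp: Bminus_def intro!: open_Int open_fst_neq\<close>)

text \<open>By uniform convergence on the region, \<open>escape a\<close> itself serves as the
  neighbourhood.\<close>

lemma escape_Bplus:
  assumes "a > 1" "p \<in> escape a"
  shows "p \<in> Bplus a"
  unfolding Bplus_def
proof (rule basinI[of "escape a"])
  show "open (escape a)"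
    unfolding escape_def case_prod_beta
    by (intro open_Collect_conj open_Collect_disj open_Collect_less continuous_intros)
  show "iter_defined (indet_f a) (f_ext a) n (emb q)" if "q \<in> escape a" for n q
    using trap_iter_defined[OF assms(1) escape_trap[OF assms(1) that]] .
  show "\<forall>\<^sub>F n in sequentially. \<forall>q\<in>escape a. (f_ext a ^^ n) (emb q) \<in> near e" if "e > 0" for e
    using trap_converges[OF assms(1) that] by eventually_elim (use escape_trap[OF assms(1)] in blast)
qed fact

lemma fmap_escape_Bplus:
  assumes "a > 1" "x \<noteq> 1" "fmap a (x, y) \<in> escape a"
  shows "(x, y) \<in> Bplus a"
  using assms by (intro Bplus_pullback escape_Bplus)

text \<open>The vertical line through the indeterminacy point \<open>(1, 0)\<close> is mapped to \<open>(\<infinity>, a)\<close>, which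
  lies in the trapping region.\<close>

lemma line_Bplus:
  assumes a: "a > 1" and y: "y \<noteq> 0"
  shows "(1, y) \<in> Bplus a"
  unfolding Bplus_def
proof (rule basinI)
  \<comment> \<open>On this double wedge, off \<open>s = 1\<close>, the image satisfies
    \<open>\<bar>x'\<bar> > 2 * (s + a)\<close>, which puts it in \<open>escape a\<close> for either
    sign of \<open>x'\<close>.\<close>
  let ?U = "{z :: real \<times> real. 0 < fst z \<and> 2 * \<bar>fst z - 1\<bar> < \<bar>snd z\<bar>}"
  show "open ?U"
    by (intro open_Collect_conj open_Collect_less continuous_intros)
  show "(1, y) \<in> ?U" using y by simp
  have U: "emb z \<notin> indet_f a \<and> f_ext a (emb z) \<in> trap a" if "z \<in> ?U" for z
  proof -
    obtain s t where z: "z = (s, t)" by fastforce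
    have st: "s > 0" "2 * \<bar>s - 1\<bar> < \<bar>t\<bar>" using that z by auto
    show ?thesis
    proof (cases "s = 1")
      case True
      then have "emb z \<notin> indet_f a" using st z a by (simp add: emb_def indet_f_def)
      moreover have "f_ext a (emb z) = (pr 1 0, Some a)"
        using calculation True z by (simp add: f_ext_eq[OF a] Fx_def emb_def hcoord_def pr_def)
      moreover have "trapped a 0 a" using a by (simp add: trapped_def)
      ultimately show ?thesis by (auto simp: trap_def)
    next
      case False
      define x' where "x' = t * ((s + a) / (s - 1))"
      have "2 * (s + a) * \<bar>s - 1\<bar> = 2 * \<bar>s - 1\<bar> * (s + a)" by simp
      also have "\<dots> < \<bar>t\<bar> * (s + a)" using st a by (intro mult_strict_right_mono) auto
      also have "\<dots> = \<bar>x'\<bar> * \<bar>s - 1\<bar>" using st a False by (simp add: x'_def abs_mult)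
      finally have "2 * (s + a) < \<bar>x'\<bar>" by (rule mult_right_less_imp_less) simp
      moreover have "fmap a z = (x', s + a - 1)" by (simp add: z fmap_def x'_def)
      ultimately have "fmap a z \<in> escape a" using st a by (auto simp: escape_def)
      then show ?thesis using False escape_trap[OF a] by (simp add: z f_ext_emb[OF a])
    qed
  qed
  show "iter_defined (indet_f a) (f_ext a) n (emb z)" if "z \<in> ?U" for n z
  proof (cases n)
    case (Suc m)
    then show ?thesis using U[OF that] trap_iter_defined[OF a] by (simp add: iter_defined_Suc)
  qed (simp add: iter_defined_def)
  fix e :: real assume "e > 0"
  from trap_converges[OF a this]
  have "\<forall>\<^sub>F n in sequentially. \<forall>z\<in>?U. (f_ext a ^^ Suc n) (emb z) \<in> near e"
    by eventually_elim (use U in \<open>auto simp: funpow_Suc_right simp del: funpow.simps(2)\<close>)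
  then show "\<forall>\<^sub>F n in sequentially. \<forall>z\<in>?U. (f_ext a ^^ n) (emb z) \<in> near e"
    by (rule eventually_sequentially_Suc[THEN iffD1])
qed

text \<open>The image \<open>(a, a - 1)\<close> lies in the right branch of
  \<open>escape a\<close>.\<close>

lemma indet_Bplus:
  assumes "a > 1"
  shows "(0, - 1) \<in> Bplus a"
  using assms by (intro fmap_escape_Bplus) (auto simp: fmap_def escape_def)

lemma contracted_Bplus:
  assumes "a > 1"
  shows "(- a, y) \<in> Bplus a"
  using assms indet_Bplus[OF assms] by (intro Bplus_pullback) (auto simp: fmap_def)

section \<open>Regions outside the square, case by case\<close>

text \<open>Off \<open>x = 1\<close>, one step lands in the left branch: the new second coordinate
  is in \<open>(0, a]\<close>, below \<open>1 - x'\<close>.\<close>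

lemma above_Bplus:
  assumes a: "a > 1" and x: "0 \<le> x" "x \<le> 1" and y: "y > a"
  shows "(x, y) \<in> Bplus a"
proof (cases "x = 1")
  case False
  define x' where "x' = y * ((x + a) / (x - 1))"
  have "a * (1 - x) \<le> a * (x + a)" using a x by (intro mult_left_mono) auto
  also have "\<dots> < y * (x + a)" using a x y by simp
  finally have "x' < - a" using False x by (simp add: x'_def field_simps)
  moreover have "fmap a (x, y) = (x', x + a - 1)" by (simp add: fmap_def x'_def)
  ultimately have "fmap a (x, y) \<in> escape a" using a x by (simp add: escape_def)
  then show ?thesis using fmap_escape_Bplus a False by blast
qed (use line_Bplus a y in auto)

lemma below_Bplus:
  assumes a: "a > 1" and x: "0 \<le> x" "x \<le> 1" and y: "y < - 1"
  shows "(x, y) \<in> Bplus a"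
proof (cases "x = 1")
  case False
  define x' where "x' = y * ((x + a) / (x - 1))"
  have "y * (x + a) < - 1 * (x + a)" using a x y by (intro mult_strict_right_mono) auto
  then have "x' > 1" using False x a by (simp add: x'_def field_simps)
  moreover have "fmap a (x, y) = (x', x + a - 1)" by (simp add: fmap_def x'_def)
  ultimately have "fmap a (x, y) \<in> escape a" using a x by (simp add: escape_def)
  then show ?thesis using fmap_escape_Bplus a False by blast
qed (use line_Bplus a y in auto)

lemma fourth_quadrant_Bplus:
  assumes a: "a > 1" and x: "x > 1" and y: "y \<le> - x"
  shows "(x, y) \<in> Bplus a"
proof -
  define x' where "x' = y * ((x + a) / (x - 1))"
  have "y * (x + a) \<le> - x * (x + a)" using a x y by (intro mult_right_mono) auto
  also have "\<dots> < - (x + a) * (x - 1)" using a x by (simp add: algebra_simps)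
  finally have "y * (x + a) / (x - 1) < - (x + a)" using x by (simp add: pos_divide_less_eq)
  then have "x' < - (x + a)" by (simp add: x'_def)
  moreover have "fmap a (x, y) = (x', x + a - 1)" by (simp add: fmap_def x'_def)
  ultimately have "fmap a (x, y) \<in> escape a" using a x by (simp add: escape_def)
  then show ?thesis using fmap_escape_Bplus[OF a] x by simp
qed

text \<open>The mirror image \<open>(- y, - x)\<close> is in the left branch of
  \<open>escape a\<close> for \<open>y \<ge> 1 - x\<close>, in the strip of
  \<open>above_Bplus\<close> for \<open>- 1 \<le> y \<le> 0\<close>, and in the right branch for
  \<open>y < - 1\<close>.\<close>

lemma left_covered:
  assumes a: "a > 1" and x: "x < - a"
  shows "(x, y) \<in> Bplus a \<or> (- y, - x) \<in> Bplus a"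
proof -
  consider "0 < y \<and> y < 1 - x" | "y \<ge> 1 - x" | "- 1 \<le> y \<and> y \<le> 0" | "y < - 1" by linarith
  then show ?thesis
  proof cases
    case 3
    then show ?thesis using above_Bplus[OF a, of "- y" "- x"] x by simp
  qed (use a x in \<open>auto intro!: escape_Bplus simp: escape_def\<close>)
qed

text \<open>Below \<open>y = - 1\<close> the diagonal \<open>y = - x\<close> decides whether the
  point or its mirror image satisfies \<open>fourth_quadrant_Bplus\<close>.\<close>

lemma right_covered:
  assumes a: "a > 1" and x: "x > 1"
  shows "(x, y) \<in> Bplus a \<or> (- y, - x) \<in> Bplus a"
proof -
  consider "y > 0" | "- 1 \<le> y \<and> y \<le> 0" | "y \<le> - x" | "- x < y \<and> y < - 1" by linarith
  then show ?thesis
  proof cases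
    case 1
    then show ?thesis using a x by (auto intro!: escape_Bplus simp: escape_def)
  next
    case 2
    then show ?thesis using below_Bplus[OF a, of "- y" "- x"] x by simp
  next
    case 3
    then show ?thesis using fourth_quadrant_Bplus[OF a x] by blast
  next
    case 4
    then show ?thesis using fourth_quadrant_Bplus[OF a, of "- y" "- x"] by simp
  qed
qed

lemma outside_square:
  assumes a: "a > 1" and p: "p \<notin> {-a..1} \<times> {-1..a}"
  shows "p \<in> Bplus a \<union> Bminus a"
proof -
  obtain x y where xy: "p = (x, y)" by fastforce
  \<comment> \<open>The last two alternatives are the first two for the mirror image.\<close>
  have "x < - a \<or> x > 1 \<or> - y < - a \<or> - y > 1" using p xy by auto
  then have "(x, y) \<in> Bplus a \<or> (- y, - x) \<in> Bplus a"
    using left_covered[OF a, of x y] right_covered[OF a, of x y]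
      left_covered[OF a, of "- y" "- x"] right_covered[OF a, of "- y" "- x"] by auto
  then show ?thesis
    using swapneg_Bplus_iff[OF a, of p] by (auto simp: xy swapneg_def)
qed

section \<open>The complement of the basins is invariant\<close>

text \<open>The lines \<open>x = 1\<close> and \<open>x = - a\<close> lie in the basins. Elsewhere
  \<open>fmap a\<close> is a local representation of the map with inverse \<open>finv a\<close>, so
  an image in either basin would put \<open>p\<close> in the same basin.\<close>

lemma complement_step:
  assumes a: "a > 1" and p: "p \<notin> Bplus a \<union> Bminus a"
  shows "emb p \<notin> indet_f a \<and> (\<exists>q. f_ext a (emb p) = emb q \<and> q \<notin> Bplus a \<union> Bminus a)"
proof -
  obtain x y where xy: "p = (x, y)" by fastforce
  have "(1, 0) \<in> Bminus a"
    using indet_Bplus[OF a] swapneg_Bplus_iff[OF a, of "(1, 0)"] by (simp add: swapneg_def)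
  then have "x \<noteq> 1" using p line_Bplus[OF a] by (cases "y = 0") (auto simp: xy)
  moreover have "x \<noteq> - a" using p contracted_Bplus[OF a] by (auto simp: xy)
  ultimately show ?thesis
    using f_ext_emb[OF a, of x y] Bplus_pullback[OF a, of x y] Bminus_pushforward[OF a, of x y] p
    unfolding xy by blast
qed

lemma complement_swapneg:
  assumes "a > 1" "p \<notin> Bplus a \<union> Bminus a"
  shows "swapneg p \<notin> Bplus a \<union> Bminus a"
  using assms swapneg_Bplus_iff[of a p] swapneg_Bminus_iff[of a p] by blast

lemma complement_step_inv:
  assumes a: "a > 1" and p: "p \<notin> Bplus a \<union> Bminus a"
  shows "emb p \<notin> indet_finv a \<and> (\<exists>q. finv_ext a (emb p) = emb q \<and> q \<notin> Bplus a \<union> Bminus a)"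
proof -
  obtain q where q: "emb (swapneg p) \<notin> indet_f a" "f_ext a (emb (swapneg p)) = emb q"
    "q \<notin> Bplus a \<union> Bminus a"
    using complement_step[OF a complement_swapneg[OF a p]] by blast
  have "finv_ext a (emb p) = emb (swapneg q)"
    using finv_ext_swapneg[OF a q(1)] q(2) by (simp add: emb_swapneg)
  moreover have "emb p \<notin> indet_finv a"
    using q(1) swapneg_indet[of "emb (swapneg p)" a] by (simp add: emb_swapneg)
  ultimately show ?thesis using complement_swapneg[OF a q(3)] by blast
qed

lemma iterates_in_invariant:
  assumes g: "\<And>p. p \<in> X \<Longrightarrow> emb p \<notin> I \<and> (\<exists>q. g (emb p) = emb q \<and> q \<in> X)"
    and p: "p \<in> X"
  shows "(g ^^ n) (emb p) \<in> emb ` X \<and> iter_defined I g n (emb p)"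
proof -
  have "(g ^^ n) (emb p) \<in> emb ` X" for n
  proof (induction n)
    case (Suc n)
    then obtain q where q: "(g ^^ n) (emb p) = emb q" "q \<in> X" by blast
    then have "(g ^^ Suc n) (emb p) = g (emb q)" by simp
    then show ?case using g[OF q(2)] by auto
  qed (use p in simp)
  then have "(g ^^ n) (emb p) \<in> emb ` X \<and> (g ^^ n) (emb p) \<notin> I" for n
    using g by (metis imageE)
  then show ?thesis by (simp add: iter_defined_def)
qed

text \<open>If \<open>R\<close> bounds \<open>B\<close>, an orbit entering
  \<open>near (1 / R)\<close> has a first coordinate exceeding \<open>R\<close> in absolute
  value.\<close>

lemma bounded_not_in_basin:
  assumes "bounded B" "\<And>n. (g ^^ n) (emb p) \<in> emb ` B"
  shows "p \<notin> basin I g"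
proof
  assume "p \<in> basin I g"
  then obtain U where U: "open U" "p \<in> U" "\<And>n q. q \<in> U \<Longrightarrow> iter_defined I g n (emb q)"
    "\<And>e. e > 0 \<Longrightarrow> \<forall>\<^sub>F n in sequentially. \<forall>q\<in>U. (g ^^ n) (emb q) \<in> near e"
    by (rule basinE) blast
  obtain R where R: "R > 0" "\<And>q. q \<in> B \<Longrightarrow> norm q \<le> R"
    using assms(1) by (auto simp: bounded_pos)
  have "\<forall>\<^sub>F n in sequentially. (g ^^ n) (emb p) \<in> near (1 / R)"
    using U(4)[of "1 / R"] R(1) U(2) by (auto elim: eventually_mono)
  then obtain n where "(g ^^ n) (emb p) \<in> near (1 / R)"
    by (meson eventually_happens trivial_limit_sequentially)
  moreover obtain q where q: "q \<in> B" "(g ^^ n) (emb p) = emb q" using assms(2) by blast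
  ultimately have "R < \<bar>fst q\<bar>" using emb_in_near[of q "1 / R"] R(1) by (simp add: field_simps)
  moreover have "\<bar>fst q\<bar> \<le> norm q" using norm_fst_le[of "fst q" "snd q"] by simp
  ultimately show False using R(2)[OF q(1)] by linarith
qed

theorem theorem1p1:
  fixes a :: real
  assumes "a > 1"
  shows "UNIV - (Bplus a \<union> Bminus a) = K_set a \<and> compact (K_set a) \<and> K_set a \<subseteq> {-a..1} \<times> {-1..a}"
proof -
  define X where "X = UNIV - (Bplus a \<union> Bminus a)"
  have square: "X \<subseteq> {-a..1} \<times> {-1..a}"
    using outside_square[OF assms] by (auto simp: X_def)
  have bounded: "bounded X"
    using square by (rule bounded_subset[rotated]) (intro bounded_Times bounded_closed_interval)
  have step: "emb p \<notin> indet_f a \<and> (\<exists>q. f_ext a (emb p) = emb q \<and> q \<in> X)"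
    and step_inv: "emb p \<notin> indet_finv a \<and> (\<exists>q. finv_ext a (emb p) = emb q \<and> q \<in> X)"
    if "p \<in> X" for p
    using complement_step[OF assms, of p] complement_step_inv[OF assms, of p] that
    unfolding X_def by blast+
  have fwd: "(f_ext a ^^ n) (emb p) \<in> emb ` X \<and> iter_defined (indet_f a) (f_ext a) n (emb p)"
    if "p \<in> X" for p n
    using iterates_in_invariant[OF step that] .
  have bwd: "(finv_ext a ^^ n) (emb p) \<in> emb ` X \<and> iter_defined (indet_finv a) (finv_ext a) n (emb p)"
    if "p \<in> X" for p n
    using iterates_in_invariant[OF step_inv that] .
  have "X = K_set a"
  proof
    show "X \<subseteq> K_set a"
    proof
      fix p assume p: "p \<in> X"
      have "range (full_orbit a p) \<subseteq> emb ` X"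
        using fwd[OF p] bwd[OF p] by (simp add: full_orbit_def image_subset_iff)
      then show "p \<in> K_set a"
        unfolding K_set_def using fwd[OF p] bwd[OF p] bounded by blast
    qed
    show "K_set a \<subseteq> X"
    proof
      fix p assume "p \<in> K_set a"
      then obtain B where B: "bounded B" "\<And>n. full_orbit a p n \<in> emb ` B"
        by (auto simp: K_set_def image_subset_iff)
      have "(f_ext a ^^ n) (emb p) \<in> emb ` B" for n
        using B(2)[of "int n"] by (simp add: full_orbit_def)
      moreover have "(finv_ext a ^^ n) (emb p) \<in> emb ` B" for n
        \<comment> \<open>Index \<open>0\<close> falls in the forward branch of
          \<open>full_orbit\<close>, hence the case split.\<close>
        using B(2)[of "- int n"] by (cases "n = 0") (simp_all add: full_orbit_def)
      ultimately show "p \<in> X"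
        using bounded_not_in_basin[OF B(1)] by (simp add: X_def Bplus_def Bminus_def)
    qed
  qed
  moreover have "compact X"
    using bounded open_basin
    by (simp add: compact_eq_bounded_closed X_def Bplus_def Bminus_def closed_Diff open_Un)
  ultimately show ?thesis using square by (simp add: X_def)
qed

end
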